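(* For every integer $k\ge0$, $$|L_{11}(k)|=\frac{25k^5}{24}+\frac{125k^4}{24}+\frac{75k^3}{8}+\frac{175k^2}{24}+\frac{137k}{60}+\frac15+\mathcal E_{11}(k),$$ where $$\mathcal E_{11}(k)=\begin{cases}4/5,&k\equiv0\pmod5,\\-2/5,&k\equiv1\pmod5,\\2/5,&k\equiv2\pmod5,\\-4/5,&k\equiv3\pmod5,\\0,&k\equiv4\pmod5.\end{cases}$$
   Context: Notation: $q=e^{2\pi i\tau}$, $\operatorname{Im}\tau>0$; $(x_1,\dots,x_s;q)_\infty=\prod_{i=1}^s\prod_{n\ge0}(1-x_iq^n)$. For $N\ge5$ put $m=\lfloor N/2\rfloor$. For an even integer $a_0\ge0$ and $\mathbf a=(a_1,\dots,a_m)\in\mathbb Z^m$, $$f^{(N)}_{\mathbf a}(\tau)=q^{\frac N{24}S_1-\frac1{2N}S_2}(q^N;q^N)_\infty^{a_0}\prod_{j=1}^m(q^j,q^{N-j};q^N)_\infty^{a_j},\quad S_1=a_0+2\sum_{j=1}^m a_j,\quad S_2=\sum_{j=1}^m j(N-j)a_j.$$ For an integer $k\ge0$, $L_N(k)$ is the set of all $\mathbf a\in\mathbb Z^m$ such that, with $a_0=2k$, $f^{(N)}_{\mathbf a}\in M_k(\Gamma_1(N))$, the space of holomorphic modular forms of weight $k$ on $\Gamma_1(N)=\{\begin{pmatrix}a&b\\c&d\end{pmatrix}\in\mathrm{SL}_2(\mathbb Z):a\equiv d\equiv1,\ c\equiv0\pmod N\}$. Here $N=11$, $m=5$. *)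

theory Defs
  imports "HOL-Complex_Analysis.Complex_Analysis" "HOL-Number_Theory.Cong" "HOL-Library.FuncSet"
begin

definition upper_half_plane :: "complex set" where
  "upper_half_plane = {z. Im z > 0}"

definition SL2Z :: "(int^2^2) set" where
  "SL2Z = {A. det A = 1}"

definition Gamma1 :: "nat \<Rightarrow> (int^2^2) set" where
  "Gamma1 N = {A \<in> SL2Z. [A$1$1 = 1] (mod int N) \<and> [A$2$2 = 1] (mod int N)
                          \<and> [A$2$1 = 0] (mod int N)}"

definition moebius :: "int^2^2 \<Rightarrow> complex \<Rightarrow> complex" where
  "moebius A z = (of_int (A$1$1) * z + of_int (A$1$2)) / (of_int (A$2$1) * z + of_int (A$2$2))"

definition slash :: "nat \<Rightarrow> int^2^2 \<Rightarrow> (complex \<Rightarrow> complex) \<Rightarrow> complex \<Rightarrow> complex" where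
  "slash k A f z = f (moebius A z) / (of_int (A$2$1) * z + of_int (A$2$2)) ^ k"

definition bounded_at_ii_inf :: "(complex \<Rightarrow> complex) \<Rightarrow> bool" where
  "bounded_at_ii_inf g \<longleftrightarrow> (\<exists>B>0. \<exists>C. \<forall>z. Im z \<ge> B \<longrightarrow> norm (g z) \<le> C)"

text \<open>
  Holomorphic modular forms of weight \<open>k\<close> on \<open>\<Gamma>\<close>. Holomorphy at all the cusps is expressed by
  boundedness of \<open>f\<close> slashed with \<open>A\<close> near \<open>\<i>\<infinity>\<close>, for every \<open>A\<close> in \<open>SL\<^sub>2(\<int>)\<close>. The functions are total;
  their values outside the upper half-plane are unconstrained.
\<close>
definition modular_forms :: "nat \<Rightarrow> (int^2^2) set \<Rightarrow> (complex \<Rightarrow> complex) set" where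
  "modular_forms k \<Gamma> = {f. f holomorphic_on upper_half_plane
     \<and> (\<forall>A\<in>\<Gamma>. \<forall>z\<in>upper_half_plane. slash k A f z = f z)
     \<and> (\<forall>A\<in>SL2Z. bounded_at_ii_inf (slash k A f))}"

text \<open>\<open>qpow r \<tau>\<close> is \<open>q\<^sup>r\<close> for \<open>q = exp (2 \<pi> \<i> \<tau>)\<close>, with the branch \<open>exp (2 \<pi> \<i> r \<tau>)\<close> for real \<open>r\<close>.\<close>
definition qpow :: "real \<Rightarrow> complex \<Rightarrow> complex" where
  "qpow r \<tau> = exp (2 * of_real pi * \<i> * of_real r * \<tau>)"

definition qpoch_inf :: "complex \<Rightarrow> complex \<Rightarrow> complex" where
  "qpoch_inf x q = (\<Prod>n. 1 - x * q ^ n)"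

definition S1 :: "nat \<Rightarrow> nat \<Rightarrow> (nat \<Rightarrow> int) \<Rightarrow> int" where
  "S1 N a0 a = int a0 + 2 * (\<Sum>j=1..N div 2. a j)"

definition S2 :: "nat \<Rightarrow> (nat \<Rightarrow> int) \<Rightarrow> int" where
  "S2 N a = (\<Sum>j=1..N div 2. int (j * (N - j)) * a j)"

definition theta_quotient :: "nat \<Rightarrow> nat \<Rightarrow> (nat \<Rightarrow> int) \<Rightarrow> complex \<Rightarrow> complex" where
  "theta_quotient N a0 a \<tau> =
     qpow (real N / 24 * of_int (S1 N a0 a) - 1 / (2 * real N) * of_int (S2 N a)) \<tau>
     * qpoch_inf (qpow (real N) \<tau>) (qpow (real N) \<tau>) ^ a0
     * (\<Prod>j=1..N div 2.
          (qpoch_inf (qpow (real j) \<tau>) (qpow (real N) \<tau>)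
           * qpoch_inf (qpow (real (N - j)) \<tau>) (qpow (real N) \<tau>)) powi a j)"

text \<open>
  Vectors in \<open>\<int>\<^sup>m\<close>, \<open>m = \<lfloor>N/2\<rfloor>\<close>, are functions on \<open>{1..m}\<close> made extensional, so that
  distinct functions in the set are distinct vectors.
\<close>
definition L :: "nat \<Rightarrow> nat \<Rightarrow> (nat \<Rightarrow> int) set" where
  "L N k = {a \<in> {1..N div 2} \<rightarrow>\<^sub>E UNIV. theta_quotient N (2 * k) a \<in> modular_forms k (Gamma1 N)}"

definition E11 :: "nat \<Rightarrow> real" where
  "E11 k = (if k mod 5 = 0 then 4/5
            else if k mod 5 = 1 then -2/5
            else if k mod 5 = 2 then 2/5
            else if k mod 5 = 3 then -4/5
            else 0)"

end

theory Submission
  imports Defs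
begin

text \<open>
Let \<open>\<eta>\<close> be the Dedekind eta function and let \<open>K\<close> denote the Klein forms \<open>klein u v\<close>, which have
weight \<open>-1\<close>. With \<open>s = k + a\<^sub>1 + \<dots> + a\<^sub>5\<close>, the theta quotient of an exponent vector \<open>a\<close> is \<open>F(11
\<tau>)\<close>, where \<open>F\<close> is the product of \<open>\<eta>\<^sup>2\<close> to the power \<open>s\<close> and of the \<open>K(j/11, 0)\<close> to the powers
\<open>a\<^sub>j\<close> (\<open>theta_quotient_eq_klein\<close>).

Klein forms are permuted by the whole modular group, without multiplier: a matrix acts on the row
vector \<open>(u, v)\<close> by right multiplication (\<open>klein_modular\<close>), and shifting \<open>(u, v)\<close> by an integral
vector only multiplies the form by a root of unity (\<open>klein_plus_int\<close>). The first fact is the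
transformation law of the odd Jacobi theta function, normalised to have derivative \<open>-2 \<pi> \<i>\<close> at
\<open>0\<close>: both sides of the law are entire functions of \<open>z\<close> with the same quasi-periods, and their
quotient is an elliptic function without poles (\<open>theta_function_unique\<close>). The law for \<open>\<eta>\<close> follows,
since the product of the three Klein forms at the \<open>2\<close>-torsion points is a constant multiple of \<open>\<eta>\<close>
to the power \<open>-6\<close> (\<open>klein_2torsion_eta_sq\<close>).

Invariance under \<open>\<tau> \<mapsto> \<tau> + 1\<close> forces \<open>6 dvd s\<close> and \<open>11 dvd \<Sum> j\<^sup>2 a\<^sub>j\<close>; invariance under \<open>\<tau> \<mapsto> \<tau> /
(11 \<tau> + 1)\<close> improves the first condition to \<open>12 dvd s\<close>, and then all of \<open>\<Gamma>\<^sub>1(11)\<close> acts trivially.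
The size of the form near each cusp is that of a power of \<open>q\<close>, and holomorphy says that its
exponent is nonnegative. Up to a positive factor, this exponent is \<open>s/12\<close> at the cusps above \<open>0\<close>,
and there are five more values \<open>o\<^sub>1, \<dots>, o\<^sub>5\<close> at the cusps above \<open>\<infinity>\<close>. This is the criterion
\<open>theta_quotient_11_modular_iff\<close>.

Put \<open>s = 12 n\<close> and scale \<open>o\<^sub>1, \<dots>, o\<^sub>5\<close> to integers. They determine \<open>a\<close>, their sum is \<open>5 (k - n)\<close>,
and the values that occur for nonnegative \<open>n\<close> are cut out by one congruence modulo \<open>5\<close>. So \<open>card
(L 11 k)\<close> counts compositions of \<open>5 m\<close> (\<open>m \<le> k\<close>) into five parts with a prescribed weight modulo
\<open>5\<close> (\<open>card_L_11\<close>). A fifth roots of unity filter gives this number: for a primitive fifth root of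
unity \<open>z\<close>, the complete homogeneous polynomial of degree \<open>5 m\<close> at \<open>1, z, \<dots>, z\<^sup>4\<close> equals \<open>1\<close>
(\<open>weight_sum_5\<close>). Summation over \<open>m\<close> yields the polynomial and the correction \<open>E11\<close>
(\<open>card_cusp_lists\<close>).
\<close>

section \<open>Infinite q-products\<close>

lemma convergent_prod_qpoch:
  fixes x q :: complex
  assumes "norm q < 1"
  shows "convergent_prod (\<lambda>n. 1 - x * q ^ n)"
proof -
  have "summable (\<lambda>n. norm (1 - x * q ^ n - 1))"
    using assms by (simp add: norm_mult norm_power summable_mult summable_geometric)
  then show ?thesis
    by (intro abs_convergent_prod_imp_convergent_prod summable_imp_abs_convergent_prod)
qed

lemma qpoch_inf_LIMSEQ:
  fixes x q :: complex
  assumes "norm q < 1"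
  shows "(\<lambda>n. \<Prod>i<n. 1 - x * q ^ i) \<longlonglongrightarrow> qpoch_inf x q"
  unfolding qpoch_inf_def using assms
  by (intro has_prod_imp_tendsto' convergent_prod_has_prod convergent_prod_qpoch)

lemma qpoch_inf_step:
  assumes "norm q < 1"
  shows "qpoch_inf x q = (1 - x) * qpoch_inf (x * q) q"
proof -
  have "(\<lambda>n. \<Prod>i<Suc n. 1 - x * q ^ i) \<longlonglongrightarrow> qpoch_inf x q"
    using qpoch_inf_LIMSEQ[OF assms] by (rule LIMSEQ_Suc)
  moreover have "(\<lambda>n. \<Prod>i<Suc n. 1 - x * q ^ i) = (\<lambda>n. (1 - x) * (\<Prod>i<n. 1 - (x * q) * q ^ i))"
    by (rule ext) (simp only: prod.lessThan_Suc_shift, simp add: mult.assoc)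
  moreover have "(\<lambda>n. (1 - x) * (\<Prod>i<n. 1 - (x * q) * q ^ i)) \<longlonglongrightarrow> (1 - x) * qpoch_inf (x * q) q"
    by (intro tendsto_intros qpoch_inf_LIMSEQ assms)
  ultimately show ?thesis using LIMSEQ_unique by metis
qed

lemma qpoch_inf_eq_0_iff:
  assumes "norm q < 1"
  shows "qpoch_inf x q = 0 \<longleftrightarrow> (\<exists>n. x * q ^ n = 1)"
proof
  assume "qpoch_inf x q = 0"
  then show "\<exists>n. x * q ^ n = 1"
    unfolding qpoch_inf_def
    using prodinf_nonzero[OF convergent_prod_qpoch[OF assms, of x]] by force
next
  assume "\<exists>n. x * q ^ n = 1"
  then obtain n where n: "x * q ^ n = 1" ..
  have "eventually (\<lambda>N. (\<Prod>i<N. 1 - x * q ^ i) = 0) sequentially"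
    using eventually_gt_at_top[of n] by eventually_elim (use n in \<open>force simp: prod_zero_iff\<close>)
  then have "(\<lambda>N. \<Prod>i<N. 1 - x * q ^ i) \<longlonglongrightarrow> 0"
    by (rule tendsto_eventually)
  with qpoch_inf_LIMSEQ[OF assms] show "qpoch_inf x q = 0"
    using LIMSEQ_unique by blast
qed

lemma qpoch_inf_nonzero:
  assumes "norm q < 1" "norm x < 1"
  shows "qpoch_inf x q \<noteq> 0"
proof
  assume "qpoch_inf x q = 0"
  then obtain n where n: "x * q ^ n = 1"
    using qpoch_inf_eq_0_iff assms(1) by blast
  have "norm (x * q ^ n) \<le> norm x * 1"
    unfolding norm_mult norm_power
    by (intro mult_left_mono power_le_one) (use assms in auto)
  with n assms(2) show False by simp
qed

text \<open>Two-sided bounds that are uniform in the base and the argument; they carry all growth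
  estimates at the cusps.\<close>
lemma norm_qpoch_inf_bounds:
  assumes "norm x \<le> r" "norm q \<le> s" "r < 1" "s < 1"
  shows "norm (qpoch_inf (of_real r) (of_real s)) \<le> norm (qpoch_inf x q)"
    and "norm (qpoch_inf x q) \<le> norm (qpoch_inf (- of_real r) (of_real s))"
proof -
  have r0: "0 \<le> r" "0 \<le> s"
    using assms norm_ge_zero order_trans by metis+
  have q: "norm q < 1" "norm (of_real s :: complex) < 1" using assms r0 by auto
  have le: "norm (x * q ^ i) \<le> r * s ^ i" for i
    unfolding norm_mult norm_power by (intro mult_mono power_mono) (use assms r0 in auto)
  have rs: "r * s ^ i \<le> 1" for i
    using mult_mono[of r 1 "s ^ i" 1] r0 assms by (simp add: power_le_one)
  note lims = tendsto_norm[OF qpoch_inf_LIMSEQ]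
  show "norm (qpoch_inf (of_real r) (of_real s)) \<le> norm (qpoch_inf x q)"
  proof (rule LIMSEQ_le[OF lims[OF q(2)] lims[OF q(1)]], intro exI[of _ 0] allI impI)
    fix n :: nat
    have "norm (1 - complex_of_real r * of_real s ^ i) \<le> norm (1 - x * q ^ i)" for i
    proof -
      have "norm (1 - complex_of_real r * of_real s ^ i) = \<bar>1 - r * s ^ i\<bar>"
        by (metis norm_of_real of_real_1 of_real_diff of_real_mult of_real_power)
      also have "\<dots> \<le> 1 - norm (x * q ^ i)"
        using le[of i] rs[of i] norm_triangle_ineq2[of 1 "x * q ^ i"] by simp
      also have "\<dots> \<le> norm (1 - x * q ^ i)"
        using norm_triangle_ineq2[of 1 "x * q ^ i"] by simp
      finally show ?thesis .
    qed
    then show "norm (\<Prod>i<n. 1 - complex_of_real r * of_real s ^ i) \<le> norm (\<Prod>i<n. 1 - x * q ^ i)"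
      unfolding prod_norm[symmetric] by (intro prod_mono) auto
  qed
  show "norm (qpoch_inf x q) \<le> norm (qpoch_inf (- of_real r) (of_real s))"
  proof (rule LIMSEQ_le[OF lims[OF q(1)] lims[OF q(2)]], intro exI[of _ 0] allI impI)
    fix n :: nat
    have "norm (1 - x * q ^ i) \<le> norm (1 - (- complex_of_real r) * of_real s ^ i)" for i
    proof -
      have "norm (1 - x * q ^ i) \<le> 1 + norm (x * q ^ i)"
        using norm_triangle_ineq4[of 1 "x * q ^ i"] by simp
      also have "\<dots> \<le> \<bar>1 + r * s ^ i\<bar>" using le[of i] by simp
      also have "\<dots> = norm (complex_of_real (1 + r * s ^ i))" by (simp only: norm_of_real)
      finally show ?thesis by simp
    qed
    then show "norm (\<Prod>i<n. 1 - x * q ^ i) \<le> norm (\<Prod>i<n. 1 - (- complex_of_real r) * of_real s ^ i)"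
      unfolding prod_norm[symmetric] by (intro prod_mono) auto
  qed
qed

lemma holomorphic_on_qpoch_inf:
  assumes "open S" "f holomorphic_on S" "g holomorphic_on S" "\<And>z. z \<in> S \<Longrightarrow> norm (g z) < 1"
  shows "(\<lambda>z. qpoch_inf (f z) (g z)) holomorphic_on S"
proof (rule holomorphic_uniform_sequence[OF assms(1)])
  show "(\<lambda>z. \<Prod>i<n. 1 - f z * g z ^ i) holomorphic_on S" for n
    by (intro holomorphic_intros assms)
  fix x assume "x \<in> S"
  then obtain d where d: "d > 0" "cball x d \<subseteq> S"
    using assms(1) open_contains_cball by blast
  have cont: "continuous_on (cball x d) f" "continuous_on (cball x d) g"
    using assms(2,3) d holomorphic_on_imp_continuous_on holomorphic_on_subset by blast+
  obtain w where w: "\<And>z. z \<in> cball x d \<Longrightarrow> norm (f z) \<le> norm (f w)"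
    using continuous_attains_sup[OF compact_cball _ continuous_on_norm[OF cont(1)]] d(1) by fastforce
  obtain y where y: "y \<in> cball x d" "\<And>z. z \<in> cball x d \<Longrightarrow> norm (g z) \<le> norm (g y)"
    using continuous_attains_sup[OF compact_cball _ continuous_on_norm[OF cont(2)]] d(1) by fastforce
  have gy: "norm (g y) < 1" using assms(4) y(1) d by blast
  have "uniformly_convergent_on (cball x d) (\<lambda>N z. \<Sum>n<N. norm (1 - f z * g z ^ n - 1))"
  proof (rule Weierstrass_m_test')
    show "summable (\<lambda>n. norm (f w) * norm (g y) ^ n)"
      using gy by (intro summable_mult summable_geometric) auto
    fix n z assume z: "z \<in> cball x d"
    show "norm (norm (1 - f z * g z ^ n - 1)) \<le> norm (f w) * norm (g y) ^ n"
      using w[OF z] y(2)[OF z]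
      by (auto simp: norm_mult norm_power intro!: mult_mono power_mono intro: order_trans[OF norm_ge_zero])
  qed
  then have "uniformly_convergent_on (cball x d) (\<lambda>N z. \<Prod>n<N. 1 - f z * g z ^ n)"
    by (intro uniformly_convergent_on_prod' continuous_intros cont compact_cball)
  then obtain l where l: "uniform_limit (cball x d) (\<lambda>N z. \<Prod>n<N. 1 - f z * g z ^ n) l sequentially"
    unfolding uniformly_convergent_on_def by blast
  have "l z = qpoch_inf (f z) (g z)" if "z \<in> cball x d" for z
    using tendsto_uniform_limitI[OF l that] qpoch_inf_LIMSEQ[of "g z" "f z"] assms(4)[of z] d that
    LIMSEQ_unique by blast
  then have "uniform_limit (cball x d) (\<lambda>N z. \<Prod>n<N. 1 - f z * g z ^ n)
      (\<lambda>z. qpoch_inf (f z) (g z)) sequentially"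
    using l uniform_limit_cong'[of "cball x d"] by (metis (no_types, lifting))
  with d show "\<exists>d>0. cball x d \<subseteq> S \<and> uniform_limit (cball x d)
      (\<lambda>n z. \<Prod>i<n. 1 - f z * g z ^ i) (\<lambda>z. qpoch_inf (f z) (g z)) sequentially"
    by blast
qed

lemma qpoch_inf_mult_minus:
  assumes "norm q < 1"
  shows "qpoch_inf x q * qpoch_inf (- x) q = qpoch_inf (x\<^sup>2) (q\<^sup>2)"
proof -
  have q2: "norm (q\<^sup>2) < 1"
    using assms by (simp add: norm_power power_less_one_iff)
  have "(\<lambda>n. (\<Prod>i<n. 1 - x * q ^ i) * (\<Prod>i<n. 1 - (- x) * q ^ i)) \<longlonglongrightarrow> qpoch_inf x q * qpoch_inf (- x) q"
    by (intro tendsto_intros qpoch_inf_LIMSEQ assms)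
  also have "(\<lambda>n. (\<Prod>i<n. 1 - x * q ^ i) * (\<Prod>i<n. 1 - (- x) * q ^ i)) = (\<lambda>n. \<Prod>i<n. 1 - x\<^sup>2 * (q\<^sup>2) ^ i)"
    unfolding prod.distrib[symmetric]
    by (intro ext prod.cong refl) (simp add: algebra_simps power2_eq_square power_mult_distrib)
  finally show ?thesis
    using qpoch_inf_LIMSEQ[OF q2] LIMSEQ_unique by blast
qed

lemma qpoch_inf_split_parity:
  assumes "norm q < 1"
  shows "qpoch_inf x q = qpoch_inf x (q\<^sup>2) * qpoch_inf (x * q) (q\<^sup>2)"
proof -
  have q2: "norm (q\<^sup>2) < 1"
    using assms by (simp add: norm_power power_less_one_iff)
  have eq: "(\<Prod>i<2 * n. 1 - x * q ^ i) = (\<Prod>i<n. 1 - x * (q\<^sup>2) ^ i) * (\<Prod>i<n. 1 - x * q * (q\<^sup>2) ^ i)" for n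
    by (induction n) (simp_all add: power_mult[symmetric] algebra_simps)
  have "(\<lambda>n. \<Prod>i<2 * n. 1 - x * q ^ i) \<longlonglongrightarrow> qpoch_inf x q"
    using LIMSEQ_subseq_LIMSEQ[OF qpoch_inf_LIMSEQ[OF assms], of "\<lambda>n. 2 * n"]
    by (simp add: strict_mono_def o_def)
  moreover have "(\<lambda>n. \<Prod>i<2 * n. 1 - x * q ^ i) \<longlonglongrightarrow> qpoch_inf x (q\<^sup>2) * qpoch_inf (x * q) (q\<^sup>2)"
    unfolding eq by (intro tendsto_intros qpoch_inf_LIMSEQ q2)
  ultimately show ?thesis using LIMSEQ_unique by blast
qed

text \<open>Euler's identity between partitions into distinct parts and into odd parts.\<close>
lemma qpoch_inf_euler:
  assumes "norm q < 1"
  shows "qpoch_inf (- q) q * qpoch_inf q (q\<^sup>2) = 1"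
proof -
  have q2: "norm (q\<^sup>2) < 1"
    using assms by (simp add: norm_power power_less_one_iff)
  have "qpoch_inf q q = qpoch_inf q (q\<^sup>2) * qpoch_inf (q\<^sup>2) (q\<^sup>2)"
    using qpoch_inf_split_parity[OF assms, of q] by (simp add: power2_eq_square)
  moreover have "qpoch_inf q q * qpoch_inf (- q) q = qpoch_inf (q\<^sup>2) (q\<^sup>2)"
    by (rule qpoch_inf_mult_minus[OF assms])
  ultimately show ?thesis
    using qpoch_inf_nonzero[OF q2 q2] by (metis mult.commute mult.left_commute mult_cancel_left1)
qed

section \<open>The odd Jacobi theta function\<close>

text \<open>The function \<open>e(z) = exp (2 \<pi> \<i> z)\<close>.\<close>
definition ee :: "complex \<Rightarrow> complex" where
  "ee z = exp (2 * of_real pi * \<i> * z)"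

lemma ee_0 [simp]: "ee 0 = 1"
  by (simp add: ee_def)

lemma ee_nonzero [simp]: "ee z \<noteq> 0"
  by (simp add: ee_def)

lemma ee_add: "ee (w + z) = ee w * ee z"
  by (simp add: ee_def algebra_simps exp_add)

lemma ee_diff: "ee (w - z) = ee w / ee z"
  by (simp add: ee_def algebra_simps exp_diff)

lemma ee_minus: "ee (- z) = inverse (ee z)"
  by (simp add: ee_def exp_minus)

lemma ee_power: "ee z ^ n = ee (of_nat n * z)"
  by (simp add: ee_def exp_of_nat_mult[symmetric] mult_ac)

lemma ee_power_int: "ee z powi n = ee (of_int n * z)"
  by (simp add: ee_def exp_power_int mult_ac)

lemma norm_ee: "norm (ee z) = exp (- 2 * pi * Im z)"
  by (simp add: ee_def)

lemma norm_ee_less_1 [simp]: "Im z > 0 \<Longrightarrow> norm (ee z) < 1"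
  by (simp add: norm_ee)

lemma ee_eq_1_iff: "ee z = 1 \<longleftrightarrow> (\<exists>n::int. z = of_int n)"
proof -
  have "ee z = 1 \<longleftrightarrow> (\<exists>n::int. 2 * of_real pi * \<i> * z = of_real (of_int (2 * n) * pi) * \<i>)"
    unfolding ee_def exp_eq_1 by (auto simp: complex_eq_iff)
  also have "\<dots> \<longleftrightarrow> (\<exists>n::int. z = of_int n)"
    by (intro ex_cong1) (auto simp: field_simps complex_eq_iff)
  finally show ?thesis .
qed

lemma ee_of_int [simp]: "ee (of_int n) = 1" and ee_1 [simp]: "ee 1 = 1"
  using ee_eq_1_iff[of "of_int n"] ee_eq_1_iff[of 1] by (auto intro: exI[of _ 1])

lemma holomorphic_on_ee [holomorphic_intros]:
  "f holomorphic_on S \<Longrightarrow> (\<lambda>z. ee (f z)) holomorphic_on S"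
  unfolding ee_def by (intro holomorphic_intros)

lemma ee_half: "ee (1 / 2) = -1"
  by (simp add: ee_def mult.commute[of _ "\<i>"])

text \<open>
The odd Jacobi theta function divided by a multiple of \<open>\<eta>\<^sup>3\<close>. In terms of \<open>\<zeta> = e(z)\<close> and \<open>q =
e(\<tau>)\<close> it is \<open>\<zeta>\<close> to the power \<open>-1/2\<close>, times \<open>1 - \<zeta>\<close>, times the product of \<open>(1 - \<zeta> q\<^sup>n) (1 - \<zeta>\<inverse> q\<^sup>n)
/ (1 - q\<^sup>n)\<^sup>2\<close> over \<open>n \<ge> 1\<close>. The quotient by \<open>\<eta>\<^sup>3\<close> makes its derivative at \<open>z = 0\<close> independent of
\<open>\<tau>\<close>.
\<close>
definition jtheta :: "complex \<Rightarrow> complex \<Rightarrow> complex" where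
  "jtheta z \<tau> = ee (- z / 2) * qpoch_inf (ee z) (ee \<tau>) * qpoch_inf (ee (\<tau> - z)) (ee \<tau>)
                 / qpoch_inf (ee \<tau>) (ee \<tau>) ^ 2"

lemma jtheta_eq_0_iff:
  assumes "Im \<tau> > 0"
  shows "jtheta z \<tau> = 0 \<longleftrightarrow> (\<exists>m n::int. z = of_int m * \<tau> + of_int n)"
proof -
  have q: "norm (ee \<tau>) < 1" using assms by simp
  have "jtheta z \<tau> = 0 \<longleftrightarrow> (\<exists>n. ee (z + of_nat n * \<tau>) = 1) \<or> (\<exists>n. ee (\<tau> - z + of_nat n * \<tau>) = 1)"
    using q by (simp add: jtheta_def qpoch_inf_eq_0_iff[OF q] qpoch_inf_nonzero ee_power ee_add[symmetric]
       del: ex_simps)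
       (metis less_irrefl norm_ee_less_1 norm_one qpoch_inf_eq_0_iff qpoch_inf_nonzero ee_power ee_add)
  also have "\<dots> \<longleftrightarrow> (\<exists>m n::int. z = of_int m * \<tau> + of_int n)"
  proof (intro iffI)
    assume "(\<exists>n. ee (z + of_nat n * \<tau>) = 1) \<or> (\<exists>n. ee (\<tau> - z + of_nat n * \<tau>) = 1)"
    then show "\<exists>m n::int. z = of_int m * \<tau> + of_int n"
    proof (elim disjE exE)
      fix n assume "ee (z + of_nat n * \<tau>) = 1"
      then obtain k :: int where "z + of_nat n * \<tau> = of_int k" unfolding ee_eq_1_iff ..
      then have "z = of_int (- int n) * \<tau> + of_int k" by (simp add: algebra_simps)
      then show ?thesis by blast
    next
      fix n assume "ee (\<tau> - z + of_nat n * \<tau>) = 1"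
      then obtain k :: int where "\<tau> - z + of_nat n * \<tau> = of_int k" unfolding ee_eq_1_iff ..
      then have "z = of_int (int n + 1) * \<tau> + of_int (- k)" by (simp add: algebra_simps)
      then show ?thesis by blast
    qed
  next
    assume "\<exists>m n::int. z = of_int m * \<tau> + of_int n"
    then obtain m n :: int where z: "z = of_int m * \<tau> + of_int n" by blast
    show "(\<exists>n. ee (z + of_nat n * \<tau>) = 1) \<or> (\<exists>n. ee (\<tau> - z + of_nat n * \<tau>) = 1)"
    proof (cases "m \<le> 0")
      case True
      then have "z + of_nat (nat (- m)) * \<tau> = of_int n" by (simp add: z)
      then show ?thesis by (metis ee_of_int)
    next
      case False
      then have "\<tau> - z + of_nat (nat (m - 1)) * \<tau> = of_int (- n)" by (simp add: z algebra_simps)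
      then show ?thesis by (metis ee_of_int)
    qed
  qed
  finally show ?thesis .
qed

lemma jtheta_plus_1: "jtheta (z + 1) \<tau> = - jtheta z \<tau>"
proof -
  have "ee (- (z + 1) / 2) = - ee (- z / 2)"
    by (simp add: add_divide_distrib diff_divide_distrib ee_diff ee_half)
  then show ?thesis
    by (simp add: jtheta_def ee_add ee_diff diff_diff_eq[symmetric])
qed

lemma jtheta_altdef:
  assumes "Im \<tau> > 0"
  shows "jtheta z \<tau> = ee (- z / 2) * (1 - ee z) *
     (qpoch_inf (ee (z + \<tau>)) (ee \<tau>) * qpoch_inf (ee (\<tau> - z)) (ee \<tau>) / qpoch_inf (ee \<tau>) (ee \<tau>) ^ 2)"
  using qpoch_inf_step[of "ee \<tau>" "ee z"] assms by (simp add: jtheta_def ee_add)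

lemma jtheta_plus_tau:
  assumes "Im \<tau> > 0"
  shows "jtheta (z + \<tau>) \<tau> = - ee (- z - \<tau> / 2) * jtheta z \<tau>"
proof -
  have eq: "qpoch_inf (ee (- z)) (ee \<tau>) = (1 - ee (- z)) * qpoch_inf (ee (\<tau> - z)) (ee \<tau>)"
    using qpoch_inf_step[of "ee \<tau>" "ee (- z)"] assms by (simp add: ee_add[symmetric])
  have "jtheta (z + \<tau>) \<tau> = ee (- (z + \<tau>) / 2) * (1 - ee (- z)) *
     (qpoch_inf (ee (z + \<tau>)) (ee \<tau>) * qpoch_inf (ee (\<tau> - z)) (ee \<tau>) / qpoch_inf (ee \<tau>) (ee \<tau>) ^ 2)"
    by (simp add: jtheta_def eq)
  also have "ee (- (z + \<tau>) / 2) * (1 - ee (- z)) = - ee (- z - \<tau> / 2) * (ee (- z / 2) * (1 - ee z))"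
  proof -
    have "ee (- (z + \<tau>) / 2) * ee (- z) = ee (- z - \<tau> / 2) * ee (- z / 2)"
      unfolding ee_add[symmetric] by (rule arg_cong[where f = ee]) (simp add: field_simps)
    moreover have "ee (- (z + \<tau>) / 2) = ee (- z - \<tau> / 2) * ee (- z / 2) * ee z"
      unfolding ee_add[symmetric] by (rule arg_cong[where f = ee]) (simp add: field_simps)
    ultimately show ?thesis by (simp only: right_diff_distrib mult_1_right) (simp add: mult.assoc)
  qed
  finally show ?thesis unfolding jtheta_altdef[OF assms] by (simp only: mult.assoc)
qed

lemma jtheta_plus_nat_tau:
  assumes "Im \<tau> > 0"
  shows "jtheta (z + of_nat m * \<tau>) \<tau> = ee (of_nat m / 2 - of_nat m ^ 2 * \<tau> / 2 - of_nat m * z) * jtheta z \<tau>"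
proof (induction m)
  case (Suc m)
  have "jtheta (z + of_nat (Suc m) * \<tau>) \<tau> = jtheta ((z + of_nat m * \<tau>) + \<tau>) \<tau>"
    by (simp add: algebra_simps)
  also have "\<dots> = (ee (1/2) * ee (- (z + of_nat m * \<tau>) - \<tau> / 2) *
       ee (of_nat m / 2 - of_nat m ^ 2 * \<tau> / 2 - of_nat m * z)) * jtheta z \<tau>"
    unfolding jtheta_plus_tau[OF assms] Suc.IH ee_half by simp
  also have "ee (1/2) * ee (- (z + of_nat m * \<tau>) - \<tau> / 2) *
       ee (of_nat m / 2 - of_nat m ^ 2 * \<tau> / 2 - of_nat m * z)
     = ee (of_nat (Suc m) / 2 - of_nat (Suc m) ^ 2 * \<tau> / 2 - of_nat (Suc m) * z)"
    unfolding ee_add[symmetric]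
    by (rule arg_cong[where f = ee]) (simp add: field_simps power2_eq_square)
  finally show ?case .
qed simp

lemma jtheta_plus_nat: "jtheta (z + of_nat n) \<tau> = ee (of_nat n / 2) * jtheta z \<tau>"
proof (induction n)
  case (Suc n)
  have "jtheta (z + of_nat (Suc n)) \<tau> = jtheta ((z + of_nat n) + 1) \<tau>"
    by (simp add: algebra_simps)
  also have "\<dots> = ee (1/2) * ee (of_nat n / 2) * jtheta z \<tau>"
    unfolding jtheta_plus_1 Suc.IH ee_half by simp
  also have "ee (1/2) * ee (of_nat n / 2) = ee (of_nat (Suc n) / 2)"
    unfolding ee_add[symmetric] by (simp add: add_divide_distrib)
  finally show ?case .
qed simp

lemma jtheta_plus_lattice:
  assumes "Im \<tau> > 0"
  shows "jtheta (z + of_int m * \<tau> + of_int n) \<tau> =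
     ee ((of_int m + of_int n) / 2 - of_int m ^ 2 * \<tau> / 2 - of_int m * z) * jtheta z \<tau>"
proof -
  have 1: "jtheta (z + of_int n) \<tau> = ee (of_int n / 2) * jtheta z \<tau>" for z
  proof (cases "n \<ge> 0")
    case True
    then show ?thesis using jtheta_plus_nat[of z "nat n"] by simp
  next
    case False
    then have "jtheta z \<tau> = ee (of_int (- n) / 2) * jtheta (z + of_int n) \<tau>"
      using jtheta_plus_nat[of "z + of_int n" "nat (- n)"] by simp
    then show ?thesis by (simp add: ee_minus)
  qed
  have 2: "jtheta (z + of_int m * \<tau>) \<tau> = ee (of_int m / 2 - of_int m ^ 2 * \<tau> / 2 - of_int m * z) * jtheta z \<tau>" for z
  proof (cases "m \<ge> 0")
    case True
    then show ?thesis using jtheta_plus_nat_tau[OF assms, of z "nat m"] by simp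
  next
    case False
    then have "jtheta z \<tau> = ee (of_int (- m) / 2 - of_int m ^ 2 * \<tau> / 2 + of_int m * (z + of_int m * \<tau>))
         * jtheta (z + of_int m * \<tau>) \<tau>" (is "_ = ee ?x * _")
      using jtheta_plus_nat_tau[OF assms, of "z + of_int m * \<tau>" "nat (- m)"] by simp
    then have "ee (- ?x) * jtheta z \<tau> = jtheta (z + of_int m * \<tau>) \<tau>"
      by (metis ee_0 ee_add left_minus mult.assoc mult_1)
    moreover have "- ?x = of_int m / 2 - of_int m ^ 2 * \<tau> / 2 - of_int m * z"
      by (simp add: field_simps power2_eq_square)
    ultimately show ?thesis by (simp only:)
  qed
  have "jtheta (z + of_int m * \<tau> + of_int n) \<tau> =
     ee (of_int n / 2) * ee (of_int m / 2 - of_int m ^ 2 * \<tau> / 2 - of_int m * z) * jtheta z \<tau>"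
    unfolding 1 2 by simp
  also have "ee (of_int n / 2) * ee (of_int m / 2 - of_int m ^ 2 * \<tau> / 2 - of_int m * z) =
      ee ((of_int m + of_int n) / 2 - of_int m ^ 2 * \<tau> / 2 - of_int m * z)"
    unfolding ee_add[symmetric] by (rule arg_cong[where f = ee]) (simp add: field_simps)
  finally show ?thesis .
qed

lemma jtheta_0 [simp]: "jtheta 0 \<tau> = 0" if "Im \<tau> > 0"
  using jtheta_altdef[OF that, of 0] by simp

lemma holomorphic_jtheta:
  assumes "open S" "f holomorphic_on S" "g holomorphic_on S" "\<And>z. z \<in> S \<Longrightarrow> Im (g z) > 0"
  shows "(\<lambda>z. jtheta (f z) (g z)) holomorphic_on S"
  unfolding jtheta_def
  by (intro holomorphic_intros holomorphic_on_qpoch_inf assms) (use assms in \<open>auto simp: qpoch_inf_nonzero\<close>)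

lemma jtheta_has_derivative_0:
  assumes "Im \<tau> > 0"
  shows "((\<lambda>z. jtheta z \<tau>) has_field_derivative - (2 * of_real pi * \<i>)) (at 0)"
proof -
  define g where "g = (\<lambda>z. ee (- z / 2) * (qpoch_inf (ee (z + \<tau>)) (ee \<tau>) *
      qpoch_inf (ee (\<tau> - z)) (ee \<tau>) / qpoch_inf (ee \<tau>) (ee \<tau>) ^ 2))"
  have nz: "qpoch_inf (ee \<tau>) (ee \<tau>) \<noteq> 0" using assms by (simp add: qpoch_inf_nonzero)
  have "g holomorphic_on UNIV"
    unfolding g_def
    by (intro holomorphic_intros holomorphic_on_qpoch_inf) (use assms nz in auto)
  then obtain g' where g': "(g has_field_derivative g') (at 0)"
    by (meson UNIV_I field_differentiable_def holomorphic_on_imp_differentiable_at open_UNIV)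
  have "((\<lambda>z. (1 - ee z) * g z) has_field_derivative
      ((0 - 2 * of_real pi * \<i>) * g 0 + g' * (1 - ee 0))) (at 0)"
    unfolding ee_def by (rule DERIV_mult' derivative_eq_intros g' refl | simp)+
  moreover have "g 0 = 1" using nz by (simp add: g_def power2_eq_square)
  moreover have "(\<lambda>z. (1 - ee z) * g z) = (\<lambda>z. jtheta z \<tau>)"
    by (simp add: fun_eq_iff jtheta_altdef[OF assms] g_def)
  ultimately show ?thesis by simp
qed

section \<open>Modularity of the theta function by Liouville's theorem\<close>

lemma periodic_of_int_mult:
  fixes f :: "complex \<Rightarrow> 'a"
  assumes "\<And>z. f (z + w) = f z"
  shows "f (z + of_int n * w) = f z"
proof (induction n rule: int_induct[where k = 0])
  case (step1 i)
  then show ?case using assms[of "z + of_int i * w"] by (simp add: algebra_simps)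
next
  case (step2 i)
  then show ?case using assms[of "z + of_int (i - 1) * w"] by (simp add: algebra_simps)
qed simp

lemma complex_basis_floor:
  assumes "Im \<tau> > 0"
  obtains m n :: int and s t :: real where "0 \<le> s" "s \<le> 1" "0 \<le> t" "t \<le> 1"
    "z = of_real s * \<tau> + of_real t + of_int m * \<tau> + of_int n * 1"
proof
  define x y where "x = Im z / Im \<tau>" and "y = Re z - x * Re \<tau>"
  have z: "z = of_real x * \<tau> + of_real y"
    using assms by (simp add: complex_eq_iff x_def y_def)
  show "z = of_real (frac x) * \<tau> + of_real (frac y) + of_int \<lfloor>x\<rfloor> * \<tau> + of_int \<lfloor>y\<rfloor> * 1"
    using z by (simp add: frac_def algebra_simps)
qed (simp_all add: frac_ge_0 less_imp_le[OF frac_lt_1])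

text \<open>
An entire function with the quasi-periods of the theta function is determined by its derivative at
\<open>0\<close>, provided that it vanishes there: the quotient \<open>f / g\<close> is doubly periodic, and its
singularities are removable because \<open>g\<close> has only simple zeros, at lattice points, where \<open>f\<close>
vanishes too.
\<close>
lemma theta_function_unique:
  fixes f g :: "complex \<Rightarrow> complex"
  assumes tau: "Im \<tau> > 0"
    and hol: "f holomorphic_on UNIV" "g holomorphic_on UNIV"
    and per1: "\<And>z. f (z + 1) = - f z" "\<And>z. g (z + 1) = - g z"
    and per2: "\<And>z. f (z + \<tau>) = - ee (- z - \<tau> / 2) * f z" "\<And>z. g (z + \<tau>) = - ee (- z - \<tau> / 2) * g z"
    and zeros: "\<And>z. g z = 0 \<Longrightarrow> \<exists>m n::int. z = of_int m * \<tau> + of_int n"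
    and der: "(f has_field_derivative D) (at 0)" "(g has_field_derivative D) (at 0)" "D \<noteq> 0"
    and 0: "f 0 = 0" "g 0 = 0"
  shows "f z = g z"
proof -
  \<comment> \<open>the quotient, with the value of its continuous extension at the lattice points\<close>
  define R where "R = (\<lambda>z. if g z = 0 then 1 else f z / g z)"
  have "R (z + 1) = R z" for z by (simp add: R_def per1)
  moreover have "R (z + \<tau>) = R z" for z by (simp add: R_def per2)
  ultimately have per: "R (z + of_int m * \<tau> + of_int n * 1) = R z" for z m n
    using periodic_of_int_mult[of R] by metis
  have lim: "((\<lambda>y. f y / y) \<longlongrightarrow> D) (at 0)" "((\<lambda>y. g y / y) \<longlongrightarrow> D) (at 0)"
    using der(1,2) 0 by (simp_all add: has_field_derivative_iff)
  have ev: "eventually (\<lambda>y. g y \<noteq> 0) (at 0)"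
    using tendsto_imp_eventually_ne[OF lim(2) der(3)] by eventually_elim auto
  then obtain d where d: "d > 0" "\<And>y. y \<in> ball 0 d - {0} \<Longrightarrow> g y \<noteq> 0"
    unfolding eventually_at by (auto simp: dist_commute)
  have "((\<lambda>y. (f y / y) / (g y / y)) \<longlongrightarrow> D / D) (at 0)"
    by (intro tendsto_intros lim der(3))
  moreover have "eventually (\<lambda>y. (f y / y) / (g y / y) = R y) (at 0)"
    unfolding eventually_at by (rule exI[of _ d]) (use d in \<open>auto simp: R_def dist_commute\<close>)
  ultimately have "(R \<longlongrightarrow> R 0) (at 0)"
    using der(3) 0 by (subst (asm) tendsto_cong) (auto simp: R_def)
  moreover have "R holomorphic_on ball 0 d - {0}"
  proof (rule holomorphic_transform)
    show "(\<lambda>z. f z / g z) holomorphic_on ball 0 d - {0}"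
      using d(2) hol[THEN holomorphic_on_subset[OF _ subset_UNIV]] by (intro holomorphic_intros) auto
  qed (use d in \<open>auto simp: R_def\<close>)
  ultimately have "R holomorphic_on ball 0 d"
  proof (intro no_isolated_singularity'[where K = "{0}" and S = "ball 0 d"])
    show "(R \<longlongrightarrow> R x) (at x within ball 0 d)" if "(R \<longlongrightarrow> R 0) (at 0)" "x \<in> {0}" for x
      using that by (auto intro: tendsto_within_subset)
  qed auto
  then have R0: "R field_differentiable (at 0)"
    using d(1) holomorphic_on_imp_differentiable_at[of R "ball 0 d" 0] by auto
  have "R field_differentiable (at w)" for w
  proof (cases "g w = 0")
    case True
    then obtain m n :: int where w: "w = of_int m * \<tau> + of_int n" using zeros by blast
    obtain R' where "(R has_field_derivative R') (at (w - w))"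
      using R0 unfolding field_differentiable_def by auto
    then have "((\<lambda>x. R (x - w)) has_field_derivative R') (at w)"
      using DERIV_shift[of R R' w "- w"] by simp
    moreover have "(\<lambda>x. R (x - w)) = R"
      using per[of _ "- m" "- n"] by (simp add: w fun_eq_iff algebra_simps)
    ultimately show ?thesis unfolding field_differentiable_def by auto
  next
    case False
    have "open {w. g w \<noteq> 0}"
      using hol(2) by (intro open_Collect_neq holomorphic_on_imp_continuous_on continuous_on_const)
    moreover have "R holomorphic_on {w. g w \<noteq> 0}"
    proof (rule holomorphic_transform)
      show "(\<lambda>z. f z / g z) holomorphic_on {w. g w \<noteq> 0}"
        using hol[THEN holomorphic_on_subset[OF _ subset_UNIV]] by (intro holomorphic_intros) auto
    qed (auto simp: R_def)
    ultimately show ?thesis using False holomorphic_on_imp_differentiable_at by blast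
  qed
  then have holR: "R holomorphic_on UNIV"
    by (simp add: holomorphic_on_def field_differentiable_at_within)
  define K where "K = (\<lambda>(s, t). complex_of_real s * \<tau> + of_real t) ` ({0..1} \<times> {0..1})"
  have "compact K"
    unfolding K_def case_prod_unfold
    by (intro compact_continuous_image continuous_intros compact_Times compact_Icc)
  then have "bounded (R ` K)"
    using holomorphic_on_imp_continuous_on[OF holR]
    by (intro compact_imp_bounded compact_continuous_image) (auto intro: continuous_on_subset)
  moreover have "range R \<subseteq> R ` K"
  proof safe
    fix w
    obtain m n :: int and s t where st: "0 \<le> s" "s \<le> 1" "0 \<le> t" "t \<le> 1"
      and w: "w = of_real s * \<tau> + of_real t + of_int m * \<tau> + of_int n * 1"
      using complex_basis_floor[OF tau] by metis
    have "R w = R (of_real s * \<tau> + of_real t)" unfolding w by (rule per)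
    then show "R w \<in> R ` K" using st unfolding K_def by force
  qed
  ultimately have "bounded (range R)" by (rule bounded_subset)
  then have "R constant_on UNIV" using holR Liouville_theorem by blast
  then have "R z = R 0" unfolding constant_on_def by auto
  then have R1: "R z = 1" by (simp add: R_def 0)
  show ?thesis
  proof (cases "g z = 0")
    case True
    then obtain m n :: int where z: "z = of_int m * \<tau> + of_int n" using zeros by blast
    define N where "N = (\<lambda>z. f z = 0)"
    have "N (x + 1) = N x" "N (x + \<tau>) = N x" for x by (simp_all add: N_def per1 per2)
    then have "N (0 + of_int m * \<tau> + of_int n * 1) = N 0"
      using periodic_of_int_mult[of N] by metis
    then show ?thesis using True z 0 by (simp add: N_def)
  next
    case False
    then show ?thesis using R1 by (simp add: R_def)
  qed
qed

lemma Im_moebius_pos: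
  fixes a b c d :: int
  assumes "a * d - b * c = 1" "Im \<tau> > 0"
  shows "Im ((of_int a * \<tau> + of_int b) / (of_int c * \<tau> + of_int d)) > 0"
    and "of_int c * \<tau> + of_int d \<noteq> 0"
proof -
  show nz: "of_int c * \<tau> + of_int d \<noteq> 0"
  proof
    assume "of_int c * \<tau> + of_int d = 0"
    then have "Im (of_int c * \<tau> + of_int d) = 0" "Re (of_int c * \<tau> + of_int d) = 0" by simp_all
    then have "c = 0" "d = 0" using assms(2) by auto
    with assms(1) show False by simp
  qed
  have "Im ((of_int a * \<tau> + of_int b) / (of_int c * \<tau> + of_int d)) =
     of_int (a * d - b * c) * Im \<tau> / (norm (of_int c * \<tau> + of_int d))\<^sup>2"
    by (simp add: Im_divide cmod_power2 algebra_simps)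
  then show "Im ((of_int a * \<tau> + of_int b) / (of_int c * \<tau> + of_int d)) > 0"
    using assms nz by simp
qed

text \<open>Transformation of \<open>jtheta\<close> under \<open>SL\<^sub>2(\<int>)\<close>: weight \<open>-1\<close> and index \<open>1/2\<close>, with trivial multiplier.\<close>
lemma jtheta_modular:
  fixes a b c d :: int
  assumes det: "a * d - b * c = 1" and tau: "Im \<tau> > 0"
  defines "J \<equiv> of_int c * \<tau> + of_int d"
  shows "jtheta (z / J) ((of_int a * \<tau> + of_int b) / J) = ee (of_int c * z\<^sup>2 / (2 * J)) / J * jtheta z \<tau>"
proof -
  define \<tau>' where "\<tau>' = (of_int a * \<tau> + of_int b) / J"
  have tau': "Im \<tau>' > 0" and J: "J \<noteq> 0"
    using Im_moebius_pos[OF det tau] by (simp_all add: \<tau>'_def J_def)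
  have det': "(of_int a * of_int d - of_int b * of_int c :: complex) = 1"
    using det by (metis of_int_1 of_int_diff of_int_mult)
  have J1: "1 / J = of_int (- c) * \<tau>' + of_int a" 
    using J det' by (simp add: \<tau>'_def field_simps) (simp add: J_def algebra_simps)
  have J2: "\<tau> / J = of_int d * \<tau>' + of_int (- b)"
  proof -
    have "\<tau> = of_int d * (of_int a * \<tau> + of_int b) - of_int b * J"
      using det' unfolding J_def by algebra
    then show ?thesis using J by (simp add: \<tau>'_def field_simps)
  qed
  have par1: "odd (a - c - a * c)" using det by (metis even_add even_diff even_mult_iff odd_one)
  have par2: "odd (d - b - b * d)" using det by (metis even_add even_diff even_mult_iff odd_one)
  have parity: "ee (of_int k / 2) = -1" if "odd k" for k :: int
  proof -
    from that obtain l where "k = 2 * l + 1" by (elim oddE)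
    then show ?thesis by (simp add: add_divide_distrib ee_add ee_half)
  qed
  \<comment> \<open>the claim is that \<open>G\<close> is the theta function of the lattice \<open>\<int> \<tau> + \<int>\<close>\<close>
  define G where "G = (\<lambda>z. J * ee (- (of_int c * z\<^sup>2 / (2 * J))) * jtheta (z / J) \<tau>')"
  define i where "i = 1 / J"
  have divJ: "x / J = x * i" "x / (2 * J) = x * i / 2" for x by (simp_all add: i_def)
  have i: "J * i = 1" using J by (simp add: i_def)
  have shift: "G (z + w) = ee (of_int k / 2 + e) * G z"
    if w: "w / J = of_int m * \<tau>' + of_int n" and 
       e: "of_int c * (2 * z * w + w\<^sup>2) * i + of_int m ^ 2 * \<tau>' + 2 * of_int m * z * i
           = of_int m + of_int n - of_int k - 2 * e" for w z m n k e
  proof -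
    have "of_int c * (z + w)\<^sup>2 * i = of_int c * z\<^sup>2 * i + of_int c * (2 * z * w + w\<^sup>2) * i"
      by (simp add: algebra_simps power2_eq_square)
    also have "of_int c * (2 * z * w + w\<^sup>2) * i = of_int m + of_int n - of_int k - 2 * e
        - of_int m ^ 2 * \<tau>' - 2 * of_int m * z * i"
      using e by (simp add: algebra_simps)
    finally have eq: "of_int c * (z + w)\<^sup>2 * i = of_int c * z\<^sup>2 * i + (of_int m + of_int n - of_int k - 2 * e
        - of_int m ^ 2 * \<tau>' - 2 * of_int m * z * i)" .
    have e': "- (of_int c * (z + w)\<^sup>2 / (2 * J))
        + ((of_int m + of_int n) / 2 - of_int m ^ 2 * \<tau>' / 2 - of_int m * (z / J))
           = of_int k / 2 + e + - (of_int c * z\<^sup>2 / (2 * J))"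
      unfolding divJ eq by (simp add: field_simps)
    have "jtheta ((z + w) / J) \<tau>' = jtheta (z / J + of_int m * \<tau>' + of_int n) \<tau>'"
      by (simp add: add_divide_distrib w add.assoc)
    also have "\<dots> = ee ((of_int m + of_int n) / 2 - of_int m ^ 2 * \<tau>' / 2 - of_int m * (z / J)) * jtheta (z / J) \<tau>'"
      by (rule jtheta_plus_lattice[OF tau'])
    finally have "G (z + w) = J * (ee (- (of_int c * (z + w)\<^sup>2 / (2 * J))) *
       ee ((of_int m + of_int n) / 2 - of_int m ^ 2 * \<tau>' / 2 - of_int m * (z / J))) * jtheta (z / J) \<tau>'"
      by (simp add: G_def)
    also have "\<dots> = ee (of_int k / 2 + e) * G z"
      unfolding ee_add[symmetric] e' unfolding ee_add G_def by simp
    finally show ?thesis .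
  qed
  have "G z = jtheta z \<tau>"
  proof (rule theta_function_unique[where f = G and g = "\<lambda>z. jtheta z \<tau>" and D = "- (2 * of_real pi * \<i>)", OF tau])
    show "G holomorphic_on UNIV"
      unfolding G_def by (intro holomorphic_intros holomorphic_jtheta) (use J tau' in auto)
    show "(\<lambda>z. jtheta z \<tau>) holomorphic_on UNIV"
      by (intro holomorphic_intros holomorphic_jtheta) (use tau in auto)
    show "jtheta (z + 1) \<tau> = - jtheta z \<tau>" for z by (rule jtheta_plus_1)
    show "jtheta (z + \<tau>) \<tau> = - ee (- z - \<tau> / 2) * jtheta z \<tau>" for z by (rule jtheta_plus_tau[OF tau])
    show "\<exists>m n::int. z = of_int m * \<tau> + of_int n" if "jtheta z \<tau> = 0" for z
      using that jtheta_eq_0_iff[OF tau] by simp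
    show "((\<lambda>z. jtheta z \<tau>) has_field_derivative - (2 * of_real pi * \<i>)) (at 0)"
      by (rule jtheta_has_derivative_0[OF tau])
    show "- (2 * complex_of_real pi * \<i>) \<noteq> 0" by simp
    show "G 0 = 0" using tau' by (simp add: G_def)
    show "jtheta 0 \<tau> = 0" using tau by simp
    show "(G has_field_derivative - (2 * of_real pi * \<i>)) (at 0)"
    proof -
      have "((\<lambda>z. jtheta z \<tau>') has_field_derivative - (2 * of_real pi * \<i>)) (at (0 / J))"
        using jtheta_has_derivative_0[OF tau'] by simp
      then have 1: "((\<lambda>z. jtheta (z / J) \<tau>') has_field_derivative - (2 * of_real pi * \<i>) * (1 / J)) (at 0)"
        by (rule DERIV_chain2) (rule DERIV_cdivide[OF DERIV_ident])
      have "(\<lambda>z. J * ee (- (of_int c * z\<^sup>2 / (2 * J)))) holomorphic_on UNIV"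
        by (intro holomorphic_intros) (use J in auto)
      then obtain D where D: "((\<lambda>z. J * ee (- (of_int c * z\<^sup>2 / (2 * J)))) has_field_derivative D) (at 0)"
        by (meson UNIV_I field_differentiable_def holomorphic_on_imp_differentiable_at open_UNIV)
      show ?thesis
        using DERIV_mult'[OF D 1] J tau' by (simp add: G_def)
    qed
    show "G (z + 1) = - G z" for z
    proof -
      have "G (z + 1) = ee (of_int (a - c - a * c) / 2 + 0) * G z"
      proof (rule shift[OF J1])
        have "i = - of_int c * \<tau>' + of_int a" using J1 by (simp add: i_def)
        then have "of_int c * (2 * z + 1) * i + of_int c ^ 2 * \<tau>' - 2 * of_int c * z * i = of_int a * of_int c"
          by algebra
        then show "of_int c * (2 * z * 1 + 1\<^sup>2) * i + of_int (- c) ^ 2 * \<tau>' + 2 * of_int (- c) * z * i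
           = of_int (- c) + of_int a - of_int (a - c - a * c) - 2 * 0"
          by simp
      qed
      then show ?thesis using parity[of "a - c - a * c"] par1 by simp
    qed
    show "G (z + \<tau>) = - ee (- z - \<tau> / 2) * G z" for z
    proof -
      have "G (z + \<tau>) = ee (of_int (d - b - b * d) / 2 + (- z - \<tau> / 2)) * G z"
      proof (rule shift[OF J2])
        have "\<tau> * i = of_int d * \<tau>' - of_int b" using J2 by (simp add: divJ)
        moreover have "\<tau>' = (of_int a * \<tau> + of_int b) * i" by (simp add: \<tau>'_def divJ)
        moreover have "(of_int c * \<tau> + of_int d) * i = 1" using i by (simp add: J_def)
        ultimately have "of_int c * (2 * z * \<tau> + \<tau>\<^sup>2) * i + of_int d ^ 2 * \<tau>' + 2 * of_int d * z * i
           = 2 * z + \<tau> + of_int b * of_int d"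
          using det' by algebra
        then show "of_int c * (2 * z * \<tau> + \<tau>\<^sup>2) * i + of_int d ^ 2 * \<tau>' + 2 * of_int d * z * i
           = of_int d + of_int (- b) - of_int (d - b - b * d) - 2 * (- z - \<tau> / 2)"
          by simp
      qed
      then show ?thesis using parity[of "d - b - b * d"] par2 by (simp add: ee_add)
    qed
  qed
  moreover have "ee (of_int c * z\<^sup>2 / (2 * J)) / J * G z = jtheta (z / J) \<tau>'"
    using J by (simp add: G_def ee_minus)
  ultimately show ?thesis by (simp add: \<tau>'_def)
qed

section \<open>Klein forms and growth at infinity\<close>

text \<open>
The Klein form of the vector \<open>(u, v)\<close>, up to a constant factor: the theta function at the point \<open>u
\<tau> + v\<close>, with an exponential factor that removes the automorphy factor of index \<open>1/2\<close>.
\<close>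
definition klein :: "real \<Rightarrow> real \<Rightarrow> complex \<Rightarrow> complex" where
  "klein u v \<tau> = ee (of_real u * (of_real u * \<tau> + of_real v) / 2) * jtheta (of_real u * \<tau> + of_real v) \<tau>"

lemma klein_modular:
  fixes a b c d :: int
  assumes det: "a * d - b * c = 1" and tau: "Im \<tau> > 0"
  shows "klein u v ((of_int a * \<tau> + of_int b) / (of_int c * \<tau> + of_int d)) =
     klein (u * of_int a + v * of_int c) (u * of_int b + v * of_int d) \<tau> / (of_int c * \<tau> + of_int d)"
proof -
  define J where "J = of_int c * \<tau> + of_int d"
  define \<tau>' where "\<tau>' = (of_int a * \<tau> + of_int b) / J"
  define u' v' where "u' = u * of_int a + v * of_int c" and "v' = u * of_int b + v * of_int d"
  define z where "z = of_real u' * \<tau> + of_real v'"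
  define w where "w = of_real u * \<tau>' + of_real v"
  have J: "J \<noteq> 0" using Im_moebius_pos[OF det tau] by (simp add: J_def)
  have det': "(of_int a * of_int d - of_int b * of_int c :: complex) = 1"
    using det by (metis of_int_1 of_int_diff of_int_mult)
  have z: "z = J * w"
    using J by (simp add: z_def w_def u'_def v'_def \<tau>'_def field_simps) (simp add: J_def algebra_simps)
  have e: "of_real u * w + of_int c * (z * w) = of_real u' * z"
  proof -
    have "of_real u + of_int c * z = of_real u' * J"
      using det' unfolding z_def J_def u'_def v'_def of_real_add of_real_mult of_real_of_int_eq
      by algebra
    then show ?thesis unfolding z by algebra
  qed
  have "klein u v \<tau>' = ee (of_real u * w / 2) * jtheta (z / J) \<tau>'"
    using J by (simp add: klein_def w_def[symmetric] z)
  also have "\<dots> = ee (of_real u * w / 2) * ee (of_int c * z\<^sup>2 / (2 * J)) / J * jtheta z \<tau>"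
    unfolding \<tau>'_def J_def jtheta_modular[OF det tau] by simp
  also have "ee (of_real u * w / 2) * ee (of_int c * z\<^sup>2 / (2 * J)) = ee (of_real u' * z / 2)"
  proof -
    have "of_int c * z\<^sup>2 / (2 * J) = of_int c * (z * w) / 2"
      using J by (simp add: z power2_eq_square)
    then show ?thesis
      unfolding ee_add[symmetric] e[symmetric] by (simp only: add_divide_distrib)
  qed
  finally show ?thesis
    by (simp add: klein_def z_def u'_def v'_def \<tau>'_def J_def)
qed

lemma klein_plus_int:
  assumes "Im \<tau> > 0"
  shows "klein (u + of_int m) (v + of_int n) \<tau> =
     ee (of_real (of_int (m + n + m * n) + u * of_int n - of_int m * v) / 2) * klein u v \<tau>"
proof -
  define z where "z = of_real u * \<tau> + of_real v"
  have z': "of_real (u + of_int m) * \<tau> + of_real (v + of_int n) = z + of_int m * \<tau> + of_int n"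
    by (simp add: z_def algebra_simps)
  have "klein (u + of_int m) (v + of_int n) \<tau> =
     ee (of_real (u + of_int m) * (z + of_int m * \<tau> + of_int n) / 2) *
     ee ((of_int m + of_int n) / 2 - of_int m ^ 2 * \<tau> / 2 - of_int m * z) * jtheta z \<tau>"
    unfolding klein_def z' jtheta_plus_lattice[OF assms] by simp
  also have "ee (of_real (u + of_int m) * (z + of_int m * \<tau> + of_int n) / 2) *
     ee ((of_int m + of_int n) / 2 - of_int m ^ 2 * \<tau> / 2 - of_int m * z) =
     ee (of_real (of_int (m + n + m * n) + u * of_int n - of_int m * v) / 2) * ee (of_real u * z / 2)"
    unfolding ee_add[symmetric] 
    by (rule arg_cong[where f = ee]) (simp add: z_def field_simps power2_eq_square)
  finally show ?thesis by (simp add: klein_def z_def)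
qed

lemma norm_ee_of_real [simp]: "norm (ee (of_real x)) = 1"
  by (simp add: norm_ee)

lemma norm_klein_plus_int:
  assumes "Im \<tau> > 0"
  shows "norm (klein (u + of_int m) (v + of_int n) \<tau>) = norm (klein u v \<tau>)"
proof -
  have "norm (ee (of_real (of_int (m + n + m * n) + u * of_int n - of_int m * v) / 2)) = 1"
    using norm_ee_of_real[of "(of_int (m + n + m * n) + u * of_int n - of_int m * v) / 2"] by simp
  then show ?thesis unfolding klein_plus_int[OF assms] norm_mult by simp
qed

lemma klein_nonzero:
  assumes "Im \<tau> > 0" "u \<notin> \<int> \<or> v \<notin> \<int>"
  shows "klein u v \<tau> \<noteq> 0"
proof
  assume "klein u v \<tau> = 0"
  then obtain m n :: int where eq: "of_real u * \<tau> + of_real v = of_int m * \<tau> + of_int n"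
    using jtheta_eq_0_iff[OF assms(1)] by (auto simp: klein_def)
  have "Im (of_real u * \<tau> + of_real v) = Im (of_int m * \<tau> + of_int n)" using eq by simp
  then have u: "u = of_int m" using assms(1) by simp
  then have "complex_of_real v = of_real (of_int n)" using eq by simp
  then have "v = of_int n" by (simp only: of_real_eq_iff)
  with u assms(2) show False by auto
qed

lemma holomorphic_klein: "klein u v holomorphic_on upper_half_plane"
proof -
  have "open upper_half_plane"
    unfolding upper_half_plane_def by (simp add: open_halfspace_Im_gt)
  moreover have "0 < Im z" if "z \<in> upper_half_plane" for z
    using that by (simp add: upper_half_plane_def)
  ultimately show ?thesis
    unfolding klein_def [abs_def] by (intro holomorphic_intros holomorphic_jtheta) auto
qed

text \<open>
\<open>qorder f r\<close>: as \<open>Im \<tau>\<close> grows, \<open>f\<close> has the size of \<open>q\<close> to the real power \<open>r\<close>, up to constants and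
uniformly in \<open>Re \<tau>\<close>. The bounds are demanded on all of \<open>Im \<tau> \<ge> 1\<close>, where the functions below have
no zeros.
\<close>
definition qorder :: "(complex \<Rightarrow> complex) \<Rightarrow> real \<Rightarrow> bool" where
  "qorder f r \<longleftrightarrow> (\<exists>A>0. \<exists>B. \<forall>\<tau>. Im \<tau> \<ge> 1 \<longrightarrow>
     A * norm (ee (of_real r * \<tau>)) \<le> norm (f \<tau>) \<and> norm (f \<tau>) \<le> B * norm (ee (of_real r * \<tau>)))"

lemma qorderI:
  assumes "A > 0" "\<And>\<tau>. Im \<tau> \<ge> 1 \<Longrightarrow> A * norm (ee (of_real r * \<tau>)) \<le> norm (f \<tau>)"
     "\<And>\<tau>. Im \<tau> \<ge> 1 \<Longrightarrow> norm (f \<tau>) \<le> B * norm (ee (of_real r * \<tau>))"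
  shows "qorder f r"
  unfolding qorder_def using assms by blast

lemma qorderE:
  assumes "qorder f r"
  obtains A B where "A > 0" "B > 0" "\<And>\<tau>. Im \<tau> \<ge> 1 \<Longrightarrow> A * norm (ee (of_real r * \<tau>)) \<le> norm (f \<tau>)"
     "\<And>\<tau>. Im \<tau> \<ge> 1 \<Longrightarrow> norm (f \<tau>) \<le> B * norm (ee (of_real r * \<tau>))"
proof -
  obtain A B where AB: "A > 0" "\<And>\<tau>. Im \<tau> \<ge> 1 \<Longrightarrow> A * norm (ee (of_real r * \<tau>)) \<le> norm (f \<tau>)"
     "\<And>\<tau>. Im \<tau> \<ge> 1 \<Longrightarrow> norm (f \<tau>) \<le> B * norm (ee (of_real r * \<tau>))"
    using assms unfolding qorder_def by blast
  have "A * norm (ee (of_real r * \<i>)) \<le> B * norm (ee (of_real r * \<i>))"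
    using AB(2,3)[of "\<i>"] by (rule order_trans) simp_all
  then have "A \<le> B" by (rule mult_right_le_imp_le) simp
  with AB that show thesis by (metis order_less_le_trans)
qed

lemma qorder_cong:
  assumes "\<And>\<tau>. Im \<tau> \<ge> 1 \<Longrightarrow> norm (f \<tau>) = norm (g \<tau>)"
  shows "qorder f r \<longleftrightarrow> qorder g r"
  using assms unfolding qorder_def by (metis (no_types, lifting))

lemma qorder_ee: "qorder (\<lambda>\<tau>. ee (of_real r * \<tau> + of_real v)) r"
  by (rule qorderI[of 1 _ _ 1]) (simp_all add: ee_add norm_mult)

lemma qorder_const: "c \<noteq> 0 \<Longrightarrow> qorder (\<lambda>_. c) 0"
  by (rule qorderI[of "norm c" _ _ "norm c"]) simp_all

lemma qorder_mult:
  assumes "qorder f r" "qorder g s"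
  shows "qorder (\<lambda>\<tau>. f \<tau> * g \<tau>) (r + s)"
proof -
  obtain A B where f: "A > 0" "B > 0" "\<And>\<tau>. Im \<tau> \<ge> 1 \<Longrightarrow> A * norm (ee (of_real r * \<tau>)) \<le> norm (f \<tau>)"
     "\<And>\<tau>. Im \<tau> \<ge> 1 \<Longrightarrow> norm (f \<tau>) \<le> B * norm (ee (of_real r * \<tau>))"
    using qorderE[OF assms(1)] by metis
  obtain C D where g: "C > 0" "D > 0" "\<And>\<tau>. Im \<tau> \<ge> 1 \<Longrightarrow> C * norm (ee (of_real s * \<tau>)) \<le> norm (g \<tau>)"
     "\<And>\<tau>. Im \<tau> \<ge> 1 \<Longrightarrow> norm (g \<tau>) \<le> D * norm (ee (of_real s * \<tau>))"
    using qorderE[OF assms(2)] by metis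
  have eq: "x * y * norm (ee (of_real (r + s) * \<tau>)) =
      (x * norm (ee (of_real r * \<tau>))) * (y * norm (ee (of_real s * \<tau>)))"
    for x y \<tau> by (simp add: distrib_right ee_add norm_mult)
  show ?thesis
    by (rule qorderI[of "A * C" _ _ "B * D"]; (unfold eq norm_mult)?)
       (use f g in \<open>auto intro!: mult_mono mult_pos_pos\<close>)
qed

lemma qorder_inverse:
  assumes "qorder f r"
  shows "qorder (\<lambda>\<tau>. inverse (f \<tau>)) (- r)"
proof -
  obtain A B where f: "A > 0" "B > 0" "\<And>\<tau>. Im \<tau> \<ge> 1 \<Longrightarrow> A * norm (ee (of_real r * \<tau>)) \<le> norm (f \<tau>)"
     "\<And>\<tau>. Im \<tau> \<ge> 1 \<Longrightarrow> norm (f \<tau>) \<le> B * norm (ee (of_real r * \<tau>))"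
    using qorderE[OF assms(1)] by metis
  have eq: "inverse x * norm (ee (of_real (- r) * \<tau>)) = inverse (x * norm (ee (of_real r * \<tau>)))" for x \<tau>
    by (simp add: ee_minus norm_inverse)
  have pos: "0 < x * norm (ee (of_real r * \<tau>))" if "x > 0" for x \<tau>
    using that by simp
  show ?thesis
  proof (rule qorderI[of "inverse B" _ _ "inverse A"], unfold eq norm_inverse)
    fix \<tau> assume t: "Im \<tau> \<ge> 1"
    have n: "0 < norm (f \<tau>)" using f(1,3) t pos order_less_le_trans by blast
    show "inverse (B * norm (ee (of_real r * \<tau>))) \<le> inverse (norm (f \<tau>))"
      by (rule le_imp_inverse_le[OF f(4)[OF t] n])
    show "inverse (norm (f \<tau>)) \<le> inverse (A * norm (ee (of_real r * \<tau>)))"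
      by (rule le_imp_inverse_le[OF f(3)[OF t] pos[OF f(1)]])
  qed (use f in auto)
qed

lemma qorder_power: "qorder f r \<Longrightarrow> qorder (\<lambda>\<tau>. f \<tau> ^ n) (of_nat n * r)"
proof (induction n)
  case (Suc n)
  then show ?case using qorder_mult[of f r "\<lambda>\<tau>. f \<tau> ^ n" "of_nat n * r"]
    by (simp add: algebra_simps)
qed (simp add: qorder_const)

lemma qorder_power_int: 
  assumes "qorder f r"
  shows "qorder (\<lambda>\<tau>. f \<tau> powi n) (of_int n * r)"
proof (cases "n \<ge> 0")
  case True
  then show ?thesis using qorder_power[OF assms, of "nat n"] by (simp add: power_int_def)
next
  case False
  then show ?thesis using qorder_inverse[OF qorder_power[OF assms, of "nat (- n)"]]
    by (simp add: power_int_def power_inverse)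
qed

lemma qorder_prod:
  assumes "\<And>i. i \<in> I \<Longrightarrow> qorder (f i) (r i)"
  shows "qorder (\<lambda>\<tau>. \<Prod>i\<in>I. f i \<tau>) (\<Sum>i\<in>I. r i)"
  using assms
proof (induction I rule: infinite_finite_induct)
  case (insert x F)
  then show ?case using qorder_mult[of "f x" "r x" "\<lambda>\<tau>. \<Prod>i\<in>F. f i \<tau>" "\<Sum>i\<in>F. r i"] by simp
qed (simp_all add: qorder_const)

lemma qorder_qpoch_inf:
  assumes "u > 0"
  shows "qorder (\<lambda>\<tau>. qpoch_inf (ee (of_real u * \<tau> + of_real v)) (ee \<tau>)) 0"
proof -
  define r s where "r = exp (- 2 * pi * u)" and "s = exp (- 2 * pi)"
  have rs: "0 \<le> r" "r < 1" "0 \<le> s" "s < 1" using assms by (auto simp: r_def s_def)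
  have le: "norm (ee (of_real u * \<tau> + of_real v)) \<le> r" "norm (ee \<tau>) \<le> s" if "Im \<tau> \<ge> 1" for \<tau>
    using that assms by (simp_all add: norm_ee r_def s_def)
  have "norm (qpoch_inf (of_real r) (of_real s)) > 0"
    using rs by (simp add: qpoch_inf_nonzero)
  then show ?thesis
    by (rule qorderI[of _ _ _ "norm (qpoch_inf (- of_real r) (of_real s))"])
       (use norm_qpoch_inf_bounds[OF le rs(2,4)] in auto)
qed

text \<open>The order of a Klein form is half of \<open>f (f - 1)\<close>, where \<open>f\<close> is the fractional part of \<open>u\<close>.\<close>
lemma qorder_klein:
  assumes "u \<notin> \<int> \<or> v \<notin> \<int>"
  shows "qorder (klein u v) ((frac u ^ 2 - frac u) / 2)"
proof -
  define f where "f = frac u"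
  have f: "0 \<le> f" "f < 1" by (simp_all add: f_def frac_ge_0 frac_lt_1)
  have Q: "qorder (\<lambda>\<tau>. qpoch_inf (ee \<tau>) (ee \<tau>)) 0"
    using qorder_qpoch_inf[of 1 0] by simp
  have Q2: "qorder (\<lambda>\<tau>. inverse (qpoch_inf (ee \<tau>) (ee \<tau>) ^ 2)) 0"
    using qorder_inverse[OF qorder_power[OF Q, of 2]] by simp
  have R: "qorder (\<lambda>\<tau>. qpoch_inf (ee (of_real (1 - f) * \<tau> + of_real (- v))) (ee \<tau>)) 0"
    using f by (intro qorder_qpoch_inf) auto
  have L: "qorder (\<lambda>\<tau>. qpoch_inf (ee (of_real f * \<tau> + of_real v)) (ee \<tau>)) 0"
  \<comment> \<open>for \<open>f = 0\<close> the first factor \<open>1 - e(v)\<close> of the product does not tend to \<open>1\<close>, but it is a nonzero constant\<close>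
  proof (cases "f = 0")
    case True
    then have "v \<notin> \<int>" using assms by (auto simp: f_def frac_eq_0_iff)
    then have nz: "1 - ee (of_real v) \<noteq> 0"
      by (auto simp: ee_eq_1_iff) (metis Ints_of_int of_real_eq_iff of_real_of_int_eq)
    have "qorder (\<lambda>\<tau>. (1 - ee (of_real v)) * qpoch_inf (ee (of_real 1 * \<tau> + of_real v)) (ee \<tau>)) (0 + 0)"
      by (intro qorder_mult qorder_const qorder_qpoch_inf nz) auto
    moreover have "(1 - ee (of_real v)) * qpoch_inf (ee (of_real 1 * \<tau> + of_real v)) (ee \<tau>) =
       qpoch_inf (ee (of_real v)) (ee \<tau>)" if "Im \<tau> \<ge> 1" for \<tau>
      using qpoch_inf_step[of "ee \<tau>" "ee (of_real v)"] that by (simp add: ee_add mult.commute)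
    ultimately show ?thesis using True
      by (subst qorder_cong[where g = "\<lambda>\<tau>. (1 - ee (of_real v)) * qpoch_inf (ee (of_real 1 * \<tau> +
          of_real v)) (ee \<tau>)"]) auto
  next
    case False
    then show ?thesis using f by (intro qorder_qpoch_inf) auto
  qed
  have E: "qorder (\<lambda>\<tau>. ee (of_real ((f ^ 2 - f) / 2) * \<tau> + of_real ((f - 1) * v / 2))) ((f ^ 2 - f) / 2)"
    by (rule qorder_ee)
  have "klein f v \<tau> = ee (of_real ((f ^ 2 - f) / 2) * \<tau> + of_real ((f - 1) * v / 2)) *
     (qpoch_inf (ee (of_real f * \<tau> + of_real v)) (ee \<tau>) *
     (qpoch_inf (ee (of_real (1 - f) * \<tau> + of_real (- v))) (ee \<tau>) *
      inverse (qpoch_inf (ee \<tau>) (ee \<tau>) ^ 2)))" for \<tau>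
  proof -
    have "ee (of_real f * (of_real f * \<tau> + of_real v) / 2) * ee (- (of_real f * \<tau> + of_real v) / 2)
       = ee (of_real ((f ^ 2 - f) / 2) * \<tau> + of_real ((f - 1) * v / 2))"
      unfolding ee_add[symmetric] 
      by (rule arg_cong[where f = ee]) (simp add: field_simps power2_eq_square)
    moreover have "\<tau> - (of_real f * \<tau> + of_real v) = of_real (1 - f) * \<tau> + of_real (- v)"
      by (simp add: algebra_simps)
    ultimately show ?thesis
      unfolding klein_def jtheta_def by (simp only: divide_inverse[of _ "_ ^ 2"] mult.assoc[symmetric])
  qed
  then have "qorder (klein f v) ((f ^ 2 - f) / 2 + (0 + (0 + 0)))"
    using qorder_mult[OF E qorder_mult[OF L qorder_mult[OF R Q2]]] by (subst qorder_cong) auto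
  moreover have "norm (klein u v \<tau>) = norm (klein f v \<tau>)" if "Im \<tau> \<ge> 1" for \<tau>
    using norm_klein_plus_int[of \<tau> f "\<lfloor>u\<rfloor>" v 0] that by (simp add: f_def frac_def)
  ultimately show ?thesis
    using qorder_cong[of "klein u v" "klein f v"] by (simp add: f_def)
qed

section \<open>The square of the Dedekind eta function\<close>

text \<open>The square of the Dedekind eta function.\<close>
definition eta_sq :: "complex \<Rightarrow> complex" where
  "eta_sq \<tau> = ee (\<tau> / 12) * qpoch_inf (ee \<tau>) (ee \<tau>) ^ 2"

lemma eta_sq_nonzero: "Im \<tau> > 0 \<Longrightarrow> eta_sq \<tau> \<noteq> 0"
  by (simp add: eta_sq_def qpoch_inf_nonzero)

lemma open_upper_half_plane: "open upper_half_plane"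
  unfolding upper_half_plane_def by (simp add: open_halfspace_Im_gt)

lemma holomorphic_eta_sq: "eta_sq holomorphic_on upper_half_plane"
  unfolding eta_sq_def [abs_def]
  by (intro holomorphic_intros holomorphic_on_qpoch_inf open_upper_half_plane)
     (auto simp: upper_half_plane_def)

lemma qorder_eta_sq: "qorder eta_sq (1 / 12)"
proof -
  have "qorder (\<lambda>\<tau>. ee (of_real (1 / 12) * \<tau> + of_real 0) * qpoch_inf (ee (of_real 1 * \<tau> + of_real 0)) (ee \<tau>) ^ 2)
     (1 / 12 + of_nat 2 * 0)"
    by (intro qorder_mult qorder_ee qorder_power qorder_qpoch_inf) auto
  then show ?thesis by (simp add: eta_sq_def [abs_def])
qed

text \<open>
The product of the Klein forms at the three nonzero \<open>2\<close>-torsion points. The modular group permutes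
them up to roots of unity, which is why this product determines the behaviour of \<open>\<eta>\<close>.
\<close>
definition klein_2torsion :: "complex \<Rightarrow> complex" where
  "klein_2torsion \<tau> = klein (1/2) 0 \<tau> * klein 0 (1/2) \<tau> * klein (1/2) (1/2) \<tau>"

text \<open>
The product of the theta values at the \<open>2\<close>-torsion points collapses by Euler's identity to a power
of \<open>\<eta>\<close>.
\<close>
lemma klein_2torsion_eta_sq:
  obtains C where "C \<noteq> 0" "\<And>\<tau>. Im \<tau> > 0 \<Longrightarrow> klein_2torsion \<tau> * eta_sq \<tau> ^ 3 = C"
proof
  show "2 * ee (- 3 / 8) \<noteq> 0" by simp
  fix \<tau> assume t: "Im \<tau> > 0"
  define q p where "q = ee \<tau>" and "p = ee (\<tau> / 2)"
  define P Q where "P = qpoch_inf q q" and "Q = qpoch_inf (- q) q"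
  have q: "norm q < 1" and nz: "P \<noteq> 0" using t by (simp_all add: q_def P_def qpoch_inf_nonzero)
  have p2: "p\<^sup>2 = q" by (simp add: p_def q_def ee_power)
  have ee_m: "ee (- 1 / 2) = -1" by (simp add: ee_minus ee_half)
  have pm: "ee (\<tau> / 2 + 1 / 2) = - p" "ee (\<tau> - (\<tau> / 2 + 1 / 2)) = - p" "ee (\<tau> - \<tau> / 2) = p"
     "ee (\<tau> - 1 / 2) = - q" "ee (\<tau> / 2 - 1 / 2) = - p"
  proof -
    show "ee (\<tau> / 2 + 1 / 2) = - p" by (simp add: ee_add ee_half p_def)
    have "\<tau> - (\<tau> / 2 + 1 / 2) = \<tau> / 2 - 1 / 2" "\<tau> - \<tau> / 2 = \<tau> / 2" by (simp_all add: field_simps)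
    then show "ee (\<tau> - (\<tau> / 2 + 1 / 2)) = - p" "ee (\<tau> - \<tau> / 2) = p"
      by (simp_all add: ee_diff ee_half p_def)
    show "ee (\<tau> - 1 / 2) = - q" "ee (\<tau> / 2 - 1 / 2) = - p"
      by (simp_all add: ee_diff ee_half q_def p_def)
  qed
  have k1: "klein (1/2) 0 \<tau> = ee (- \<tau> / 8) * qpoch_inf p q ^ 2 / P ^ 2"
  proof -
    have "klein (1/2) 0 \<tau> = ee (\<tau> / 2 / 2 / 2) * ee (- (\<tau> / 2) / 2) * qpoch_inf p q ^ 2 / P ^ 2"
      unfolding klein_def jtheta_def by (simp add: pm p_def [symmetric] q_def [symmetric] P_def power2_eq_square)
    also have "ee (\<tau> / 2 / 2 / 2) * ee (- (\<tau> / 2) / 2) = ee (- \<tau> / 8)"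
      unfolding ee_add[symmetric] by (rule arg_cong[where f = ee]) simp
    finally show ?thesis .
  qed
  have k2: "klein 0 (1/2) \<tau> = 2 * ee (- 1 / 4) * Q ^ 2 / P ^ 2"
  proof -
    have "klein 0 (1/2) \<tau> = ee (- (1 / 2) / 2) * qpoch_inf (-1) q * Q / P ^ 2"
      unfolding klein_def jtheta_def 
      by (simp add: pm ee_half q_def [symmetric] P_def Q_def)
    also have "qpoch_inf (-1) q = 2 * Q"
      using qpoch_inf_step[OF q, of "-1"] by (simp add: Q_def)
    finally show ?thesis by (simp add: power2_eq_square)
  qed
  have k3: "klein (1/2) (1/2) \<tau> = ee (- \<tau> / 8 - 1 / 8) * qpoch_inf (- p) q ^ 2 / P ^ 2"
  proof -
    have "klein (1/2) (1/2) \<tau> = ee ((\<tau> / 2 + 1 / 2) / 2 / 2) * ee (- (\<tau> / 2 +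
        1 / 2) / 2) * qpoch_inf (- p) q ^ 2 / P ^ 2"
      unfolding klein_def jtheta_def by (simp add: pm q_def [symmetric] P_def power2_eq_square)
    also have "ee ((\<tau> / 2 + 1 / 2) / 2 / 2) * ee (- (\<tau> / 2 + 1 / 2) / 2) = ee (- \<tau> / 8 - 1 / 8)"
      unfolding ee_add[symmetric] by (rule arg_cong[where f = ee]) (simp add: field_simps)
    finally show ?thesis .
  qed
  have "qpoch_inf p q * qpoch_inf (- p) q * Q = 1"
    using qpoch_inf_mult_minus[OF q, of p] qpoch_inf_euler[OF q] by (simp add: p2 Q_def mult.commute)
  then have one: "(qpoch_inf p q * qpoch_inf (- p) q * Q) ^ 2 = 1" by simp
  have "klein_2torsion \<tau> * eta_sq \<tau> ^ 3 = (ee (- \<tau> / 8) * ee (- 1 / 4) * ee (- \<tau> / 8 - 1 / 8) * ee (\<tau> / 12) ^ 3)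
     * 2 * (qpoch_inf p q * qpoch_inf (- p) q * Q) ^ 2"
    using nz unfolding klein_2torsion_def k1 k2 k3 eta_sq_def
    by (simp add: q_def [symmetric] P_def [symmetric] field_simps power_mult_distrib)
  also have "ee (- \<tau> / 8) * ee (- 1 / 4) * ee (- \<tau> / 8 - 1 / 8) * ee (\<tau> / 12) ^ 3 = ee (- 3 / 8)"
    unfolding ee_power ee_add[symmetric] by (rule arg_cong[where f = ee]) (simp add: field_simps)
  finally show "klein_2torsion \<tau> * eta_sq \<tau> ^ 3 = 2 * ee (- 3 / 8)"
    unfolding one by simp
qed

lemma klein_half_int_power4:
  fixes x y x' y' :: int
  assumes "Im \<tau> > 0" "even (x - x')" "even (y - y')"
  shows "klein (of_int x / 2) (of_int y / 2) \<tau> ^ 4 = klein (of_int x' / 2) (of_int y' / 2) \<tau> ^ 4"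
proof -
  obtain m n where "x - x' = 2 * m" "y - y' = 2 * n"
    using assms(2,3) by (elim evenE)
  then have mn: "x = x' + 2 * m" "y = y' + 2 * n" by simp_all
  have "klein (of_int x / 2) (of_int y / 2) \<tau> = klein (of_int x' / 2 + of_int m) (of_int y' / 2 + of_int n) \<tau>"
    by (simp add: mn add_divide_distrib)
  also have "\<dots> = ee (of_real (of_int (m + n + m * n) + of_int x' / 2 * of_int n - of_int m * (of_int y' / 2)) / 2) 
      * klein (of_int x' / 2) (of_int y' / 2) \<tau>"
    by (rule klein_plus_int[OF assms(1)])
  finally have "klein (of_int x / 2) (of_int y / 2) \<tau> ^ 4 = 
     ee (of_nat 4 * (of_real (of_int (m + n + m * n) + of_int x' / 2 * of_int n - of_int m * (of_int y' / 2)) / 2))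
      * klein (of_int x' / 2) (of_int y' / 2) \<tau> ^ 4"
    by (simp only: power_mult_distrib ee_power)
  also have "of_nat 4 * (of_real (of_int (m + n + m * n) + of_int x' / 2 * of_int n - of_int m * (of_int y' / 2)) / 2)
     = complex_of_int (2 * (m + n + m * n) + x' * n - m * y')"
    by (simp add: field_simps)
  finally show ?thesis by (simp only: ee_of_int mult_1)
qed

lemma klein_2torsion_modular:
  fixes a b c d :: int
  assumes det: "a * d - b * c = 1" and tau: "Im \<tau> > 0"
  defines "J \<equiv> of_int c * \<tau> + of_int d"
  shows "klein_2torsion ((of_int a * \<tau> + of_int b) / J) ^ 4 = klein_2torsion \<tau> ^ 4 / J ^ 12"
proof -
  define N where "N = (\<lambda>x y::int. klein (of_int x / 2) (of_int y / 2) \<tau> ^ 4)"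
  have N: "N x y = N x' y'" if "even (x - x')" "even (y - y')" for x y x' y'
    unfolding N_def using that by (rule klein_half_int_power4[OF tau])
  have K: "klein_2torsion \<tau> ^ 4 = N 1 0 * N 0 1 * N 1 1"
    by (simp add: klein_2torsion_def N_def power_mult_distrib)
  have "klein_2torsion ((of_int a * \<tau> + of_int b) / J) ^ 4 =
      N a b / J ^ 4 * (N c d / J ^ 4) * (N (a + c) (b + d) / J ^ 4)"
    unfolding klein_2torsion_def J_def klein_modular[OF det tau] N_def
    by (simp add: power_mult_distrib power_divide add_divide_distrib)
  also have "\<dots> = (N a b * N c d * N (a + c) (b + d)) / J ^ 12"
    by (simp add: power_add[symmetric])
  also have "N a b * N c d * N (a + c) (b + d) = N 1 0 * N 0 1 * N 1 1"
  proof -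
    \<comment> \<open>modulo \<open>2\<close> the matrix is one of six and permutes the three nonzero vectors\<close>
    define r where "r = (\<lambda>x::int. if even x then 0 else 1 :: int)"
    have red: "N x y = N (r x) (r y)" for x y by (rule N) (auto simp: r_def)
    have "odd (a * d - b * c)" using det by simp
    then consider "odd a" "even b" "even c" "odd d" | "even a" "odd b" "odd c" "even d"
      | "odd a" "odd b" "odd c" "even d" | "odd a" "odd b" "even c" "odd d"
      | "odd a" "even b" "odd c" "odd d" | "even a" "odd b" "odd c" "odd d"
      by (cases "even a"; cases "even b"; cases "even c"; cases "even d") auto
    then show ?thesis
      unfolding red[of a b] red[of c d] red[of "a + c" "b + d"]
      by cases (simp_all add: r_def)
  qed
  finally show ?thesis by (simp add: K)
qed

lemma eta_sq_modular:
  fixes a b c d :: int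
  assumes det: "a * d - b * c = 1" and tau: "Im \<tau> > 0"
  defines "J \<equiv> of_int c * \<tau> + of_int d"
  shows "eta_sq ((of_int a * \<tau> + of_int b) / J) ^ 12 = J ^ 12 * eta_sq \<tau> ^ 12"
    and "norm (eta_sq ((of_int a * \<tau> + of_int b) / J)) = norm J * norm (eta_sq \<tau>)"
proof -
  define \<tau>' where "\<tau>' = (of_int a * \<tau> + of_int b) / J"
  have tau': "Im \<tau>' > 0" and J: "J \<noteq> 0"
    using Im_moebius_pos[OF det tau] by (simp_all add: \<tau>'_def J_def)
  obtain C where C: "C \<noteq> 0" "\<And>\<tau>. Im \<tau> > 0 \<Longrightarrow> klein_2torsion \<tau> * eta_sq \<tau> ^ 3 = C"
    by (rule klein_2torsion_eta_sq) auto
  have C4: "klein_2torsion t ^ 4 * eta_sq t ^ 12 = C ^ 4" if "Im t > 0" for t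
    unfolding C(2)[OF that, symmetric] by (simp add: power_mult_distrib flip: power_mult)
  have X: "klein_2torsion \<tau>' ^ 4 = klein_2torsion \<tau> ^ 4 / J ^ 12"
    unfolding \<tau>'_def J_def by (rule klein_2torsion_modular[OF det tau])
  have nz: "klein_2torsion \<tau> ^ 4 \<noteq> 0" using C4[OF tau] C(1) by auto
  have "klein_2torsion \<tau> ^ 4 * eta_sq \<tau>' ^ 12 = klein_2torsion \<tau> ^ 4 * (J ^ 12 * eta_sq \<tau> ^ 12)"
    using C4[OF tau] C4[OF tau'] J unfolding X by (simp add: field_simps)
  then show *: "eta_sq ((of_int a * \<tau> + of_int b) / J) ^ 12 = J ^ 12 * eta_sq \<tau> ^ 12"
    using nz by (simp add: \<tau>'_def)
  have "norm (eta_sq \<tau>') ^ 12 = (norm J * norm (eta_sq \<tau>)) ^ 12"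
    using arg_cong[OF *, of norm] by (simp add: \<tau>'_def norm_power norm_mult norm_divide power_mult_distrib)
  then show "norm (eta_sq ((of_int a * \<tau> + of_int b) / J)) = norm J * norm (eta_sq \<tau>)"
    unfolding \<tau>'_def by (rule power_eq_imp_eq_base) auto
qed

text \<open>
The sign is the reason why a modular theta quotient needs an exponent of \<open>\<eta>\<^sup>2\<close> divisible by \<open>12\<close>,
not only by \<open>6\<close>.
\<close>
lemma eta_sq_6_lower:
  assumes tau: "Im \<tau> > 0"
  shows "eta_sq (\<tau> / (\<tau> + 1)) ^ 6 = - ((\<tau> + 1) ^ 6 * eta_sq \<tau> ^ 6)"
proof -
  define J where "J = \<tau> + 1"
  define \<tau>' where "\<tau>' = \<tau> / J"
  have det: "(1::int) * 1 - 0 * 1 = 1" by simp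
  have tau': "Im \<tau>' > 0" and J: "J \<noteq> 0"
    using Im_moebius_pos[OF det tau] by (simp_all add: \<tau>'_def J_def)
  obtain C where C: "C \<noteq> 0" "\<And>\<tau>. Im \<tau> > 0 \<Longrightarrow> klein_2torsion \<tau> * eta_sq \<tau> ^ 3 = C"
    by (rule klein_2torsion_eta_sq) auto
  have K: "klein u v \<tau>' = klein (u + v) v \<tau> / J" for u v
    using klein_modular[OF det tau, of u v] by (simp add: \<tau>'_def J_def)
  have "klein (0 + of_int 1) (1/2 + of_int 0) \<tau> = ee (of_real (- 1 / 4) + of_int 1 / 2) * klein 0 (1/2) \<tau>"
    unfolding klein_plus_int[OF tau] by (simp add: field_simps)
  then have "klein_2torsion \<tau>' = ee (of_real (- 1 / 4) + 1 / 2) * klein_2torsion \<tau> / J ^ 3"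
    by (simp add: klein_2torsion_def K power3_eq_cube)
  moreover have "ee (of_real (- 1 / 4) + 1 / 2) ^ 2 = -1"
    by (simp add: ee_power algebra_simps ee_half)
  ultimately have X: "klein_2torsion \<tau>' ^ 2 = - (klein_2torsion \<tau> ^ 2) / J ^ 6"
    by (simp add: power_mult_distrib power_divide flip: power_mult)
  have C2: "klein_2torsion t ^ 2 * eta_sq t ^ 6 = C ^ 2" if "Im t > 0" for t
    unfolding C(2)[OF that, symmetric] by (simp add: power_mult_distrib flip: power_mult)
  have nz: "klein_2torsion \<tau> ^ 2 \<noteq> 0" using C2[OF tau] C(1) by auto
  have "- (klein_2torsion \<tau> ^ 2 * eta_sq \<tau>' ^ 6) = C ^ 2 * J ^ 6"
    using C2[OF tau'] J unfolding X by (simp add: field_simps)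
  then have "klein_2torsion \<tau> ^ 2 * eta_sq \<tau>' ^ 6 = klein_2torsion \<tau> ^ 2 * (- (J ^ 6 * eta_sq \<tau> ^ 6))"
    unfolding C2[OF tau, symmetric] by algebra
  then have "eta_sq \<tau>' ^ 6 = - (J ^ 6 * eta_sq \<tau> ^ 6)"
    by (rule mult_left_cancel[OF nz, THEN iffD1])
  then show ?thesis by (simp add: \<tau>'_def J_def)
qed

section \<open>Theta quotients as products of Klein forms\<close>

lemma qpow_eq_ee: "qpow r \<tau> = ee (of_real r * \<tau>)"
  by (simp add: qpow_def ee_def mult.assoc)

lemma ee_sum: "ee (\<Sum>i\<in>I. f i) = (\<Prod>i\<in>I. ee (f i))"
  by (induction I rule: infinite_finite_induct) (simp_all add: ee_add)

lemma prod_power_int_sum: 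
  fixes x :: "'a :: field"
  assumes "x \<noteq> 0"
  shows "(\<Prod>i\<in>I. x powi f i) = x powi (\<Sum>i\<in>I. f i)"
  using assms by (induction I rule: infinite_finite_induct) (simp_all add: power_int_add)

lemma theta_quotient_eq_klein:
  assumes "N > 0" and tau: "Im \<tau> > 0"
  defines "T \<equiv> of_nat N * \<tau>"
  shows "theta_quotient N (2 * k) a \<tau> = eta_sq T powi (int k + (\<Sum>j=1..N div 2. a j)) *
     (\<Prod>j=1..N div 2. klein (real j / real N) 0 T powi a j)"
proof -
  define I where "I = {1..N div 2}"
  define P where "P = qpoch_inf (ee T) (ee T)"
  define s where "s = (\<Sum>j\<in>I. a j)"
  have T: "Im T > 0" using assms by (simp add: T_def)
  have P: "P \<noteq> 0" using T by (simp add: P_def qpoch_inf_nonzero)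
  define c where "c = (\<lambda>j. real (j * (N - j)) / (2 * real N) - real N / 12)"
  have factor: "qpoch_inf (qpow (real j) \<tau>) (qpow (real N) \<tau>) * qpoch_inf (qpow (real (N - j)) \<tau>) (qpow (real N) \<tau>)
     = ee (of_real (c j) * \<tau>) * (eta_sq T * klein (real j / real N) 0 T)" if "j \<in> I" for j
  proof -
    have j: "j \<le> N" using that by (auto simp: I_def)
    have Nz: "complex_of_nat N \<noteq> 0" using \<open>N > 0\<close> by simp
    have jT: "of_real (real j / real N) * T + of_real 0 = of_nat j * \<tau>"
      using \<open>N > 0\<close> by (simp add: T_def)
    define U V where "U = qpoch_inf (ee (of_nat j * \<tau>)) (ee T)" and "V = qpoch_inf (ee (T - of_nat j * \<tau>)) (ee T)"
    define E where "E = ee (of_real (real j / real N) * (of_nat j * \<tau>) / 2) * ee (- (of_nat j * \<tau>) / 2)"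
    have klein: "klein (real j / real N) 0 T = E * (U * V / P ^ 2)"
      unfolding klein_def jtheta_def jT P_def U_def V_def E_def by simp
    have "ee (of_real (c j) * \<tau>) * ee (T / 12) * E = ee 0"
      unfolding ee_add[symmetric] E_def using j Nz
      by (intro arg_cong[where f = ee]) (simp add: c_def T_def of_nat_diff field_simps)
    moreover have "ee (of_real (c j) * \<tau>) * (eta_sq T * klein (real j / real N) 0 T)
      = (ee (of_real (c j) * \<tau>) * ee (T / 12) * E) * (U * V)"
      unfolding klein eta_sq_def P_def[symmetric] using P by simp
    moreover have "of_real (real (N - j)) * \<tau> = T - of_nat j * \<tau>"
      using j by (simp add: T_def of_nat_diff algebra_simps)
    then have "qpoch_inf (qpow (real j) \<tau>) (qpow (real N) \<tau>) *
        qpoch_inf (qpow (real (N - j)) \<tau>) (qpow (real N) \<tau>) = U * V"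
      unfolding qpow_eq_ee by (simp add: U_def V_def T_def)
    ultimately show ?thesis by simp
  qed
  have "(\<Prod>j\<in>I. (qpoch_inf (qpow (real j) \<tau>) (qpow (real N) \<tau>)
           * qpoch_inf (qpow (real (N - j)) \<tau>) (qpow (real N) \<tau>)) powi a j)
      = (\<Prod>j\<in>I. ee (of_int (a j) * (of_real (c j) * \<tau>)) * (eta_sq T powi a j * klein (real j / real N) 0 T powi a j))"
    by (intro prod.cong refl) (simp add: factor power_int_mult_distrib ee_power_int)
  also have "\<dots> = ee (\<Sum>j\<in>I. of_int (a j) * (of_real (c j) * \<tau>)) * eta_sq T powi s
      * (\<Prod>j\<in>I. klein (real j / real N) 0 T powi a j)"
    using eta_sq_nonzero[OF T] by (simp add: prod.distrib ee_sum prod_power_int_sum s_def)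
  finally have prod: "(\<Prod>j\<in>I. (qpoch_inf (qpow (real j) \<tau>) (qpow (real N) \<tau>)
           * qpoch_inf (qpow (real (N - j)) \<tau>) (qpow (real N) \<tau>)) powi a j) =
     ee (\<Sum>j\<in>I. of_int (a j) * (of_real (c j) * \<tau>)) * eta_sq T powi s * (\<Prod>j\<in>I. klein (real j / real N) 0 T powi a j)" .
  have P2: "qpoch_inf (qpow (real N) \<tau>) (qpow (real N) \<tau>) ^ (2 * k) = ee (- (of_nat k * T / 12)) * eta_sq T ^ k"
  proof -
    have "eta_sq T ^ k = ee (of_nat k * T / 12) * P ^ (2 * k)"
      by (simp add: eta_sq_def P_def power_mult_distrib ee_power power_mult)
    then show ?thesis by (simp add: qpow_eq_ee P_def T_def ee_minus)
  qed
  have sum: "(\<Sum>j\<in>I. of_int (a j) * (of_real (c j) * \<tau>)) =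
      of_real (of_int (S2 N a) / (2 * real N) - of_int s * real N / 12) * \<tau>"
  proof -
    have "(\<Sum>j\<in>I. of_int (a j) * c j) = of_int (S2 N a) / (2 * real N) - of_int s * real N / 12"
      by (simp add: S2_def s_def I_def c_def sum_subtractf sum_divide_distrib sum_distrib_right
          sum_distrib_left algebra_simps)
    then have "complex_of_real (\<Sum>j\<in>I. of_int (a j) * c j) * \<tau> =
        of_real (of_int (S2 N a) / (2 * real N) - of_int s * real N / 12) * \<tau>"
      by simp
    then show ?thesis by (simp add: sum_distrib_right mult.assoc)
  qed
  have "theta_quotient N (2 * k) a \<tau> = 
     (qpow (real N / 24 * of_int (S1 N (2 * k) a) - 1 / (2 * real N) * of_int (S2 N a)) \<tau> * ee (- (of_nat k *
         T / 12)) *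
      ee (\<Sum>j\<in>I. of_int (a j) * (of_real (c j) * \<tau>))) * (eta_sq T ^ k * eta_sq T powi s) *
      (\<Prod>j\<in>I. klein (real j / real N) 0 T powi a j)"
    unfolding theta_quotient_def I_def[symmetric] prod P2 by simp
  also have "qpow (real N / 24 * of_int (S1 N (2 * k) a) - 1 / (2 * real N) * of_int (S2 N a)) \<tau> *
      ee (- (of_nat k * T / 12)) *
      ee (\<Sum>j\<in>I. of_int (a j) * (of_real (c j) * \<tau>)) = ee 0"
    unfolding sum qpow_eq_ee ee_add[symmetric] using \<open>N > 0\<close>
    by (intro arg_cong[where f = ee]) (simp add: S1_def I_def s_def T_def field_simps)
  also have "eta_sq T ^ k * eta_sq T powi s = eta_sq T powi (int k + s)"
    using eta_sq_nonzero[OF T] by (simp add: power_int_add)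
  finally show ?thesis by (simp add: s_def I_def)
qed

text \<open>
Since \<open>qorder\<close> bounds \<open>f\<close> from below as well, boundedness near the cusp is equivalent to a
nonnegative order. The substitution \<open>h \<tau> + x\<close> accounts for the width of the cusp.
\<close>
lemma bounded_at_ii_inf_iff_qorder:
  assumes f: "qorder f r" and h: "h > 0" and K: "K > 0"
    and g: "\<And>\<tau>. Im \<tau> > 0 \<Longrightarrow> norm (g \<tau>) = K * norm (f (of_real h * \<tau> + of_real x))"
  shows "bounded_at_ii_inf g \<longleftrightarrow> r \<ge> 0"
proof -
  obtain A B where AB: "A > 0" "B > 0" "\<And>\<tau>. Im \<tau> \<ge> 1 \<Longrightarrow> A * norm (ee (of_real r * \<tau>)) \<le> norm (f \<tau>)"
     "\<And>\<tau>. Im \<tau> \<ge> 1 \<Longrightarrow> norm (f \<tau>) \<le> B * norm (ee (of_real r * \<tau>))"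
    using qorderE[OF f] by metis
  have im: "Im (of_real h * \<tau> + of_real x) \<ge> 1 \<and> Im \<tau> > 0" if "Im \<tau> \<ge> 1 / h" for \<tau>
  proof -
    have "Im \<tau> > 0" using that h by (meson divide_pos_pos less_le_trans zero_less_one)
    with that h show ?thesis by (simp add: field_simps)
  qed
  show ?thesis
  proof
    assume r: "r \<ge> 0"
    have "norm (g \<tau>) \<le> K * B" if "Im \<tau> \<ge> 1 / h" for \<tau>
    proof -
      have "norm (ee (of_real r * (of_real h * \<tau> + of_real x))) \<le> 1"
        using r im[OF that] h by (simp add: norm_ee)
      then have "norm (f (of_real h * \<tau> + of_real x)) \<le> B * 1"
        using AB(2) AB(4)[of "of_real h * \<tau> + of_real x"] im[OF that] 
        by (meson mult_left_mono order_trans less_imp_le)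
      then show ?thesis using g[of \<tau>] im[OF that] K by simp
    qed
    then show "bounded_at_ii_inf g"
      unfolding bounded_at_ii_inf_def using h by (intro exI[of _ "1 / h"] conjI exI[of _ "K * B"]) auto
  next
    assume "bounded_at_ii_inf g"
    then obtain Y C where Y: "Y > 0" "\<And>z. Im z \<ge> Y \<Longrightarrow> norm (g z) \<le> C"
      unfolding bounded_at_ii_inf_def by blast
    show "r \<ge> 0"
    proof (rule ccontr)
      assume "\<not> r \<ge> 0"
      then have r: "r < 0" by simp
      \<comment> \<open>a height at which the lower bound for \<open>g\<close> exceeds \<open>C\<close>, by \<open>exp y > y\<close>\<close>
      define t where "t = max (max Y (1 / h)) (C / (K * A) / (2 * pi * (- r) * h))"
      have t: "t \<ge> Y" "t \<ge> 1 / h" "t \<ge> C / (K * A) / (2 * pi * (- r) * h)" by (simp_all add: t_def)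
      have "C / (K * A) \<le> 2 * pi * (- r) * h * t"
      proof -
        have "0 < 2 * pi * (- r) * h" using r h by (intro mult_pos_pos) auto
        then show ?thesis using t(3) by (simp only: pos_divide_le_eq mult.commute[of t])
      qed
      also have "\<dots> < exp (2 * pi * (- r) * h * t)" using exp_ge_add_one_self[of "2 * pi * (- r) * h * t"] by linarith
      also have "\<dots> = norm (ee (of_real r * (of_real h * (\<i> * of_real t) + of_real x)))"
        by (simp add: norm_ee algebra_simps)
      finally have "C < K * (A * norm (ee (of_real r * (of_real h * (\<i> * of_real t) + of_real x))))"
        using K AB(1) by (simp add: field_simps)
      also have "\<dots> \<le> K * norm (f (of_real h * (\<i> * of_real t) + of_real x))"
        using AB(3) im[of "\<i> * of_real t"] t(2) K by (intro mult_left_mono) auto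
      also have "\<dots> = norm (g (\<i> * of_real t))"
        using g[of "\<i> * of_real t"] im[of "\<i> * of_real t"] t(2) by simp
      also have "\<dots> \<le> C" using Y(2)[of "\<i> * of_real t"] t(1) by simp
      finally show False by simp
    qed
  qed
qed

section \<open>Orders at the cusps for level 11\<close>

text \<open>
The product of powers of \<open>\<eta>\<^sup>2\<close> and of the Klein forms at the \<open>11\<close>-torsion vectors \<open>j (x, y) / 11\<close>.
The theta quotient itself belongs to \<open>(x, y) = (1, 0)\<close>, and the modular group acts on \<open>(x, y)\<close>.
\<close>
definition klein_quot :: "int \<Rightarrow> (nat \<Rightarrow> int) \<Rightarrow> int \<Rightarrow> int \<Rightarrow> complex \<Rightarrow> complex" where
  "klein_quot s a x y \<tau> = eta_sq \<tau> powi s *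
     (\<Prod>j=1..5. klein (of_int (int j * x) / 11) (of_int (int j * y) / 11) \<tau> powi a j)"

lemma theta_quotient_11:
  assumes "Im \<tau> > 0"
  shows "theta_quotient 11 (2 * k) a \<tau> = klein_quot (int k + (\<Sum>j=1..5. a j)) a 1 0 (11 * \<tau>)"
  using theta_quotient_eq_klein[of 11 \<tau> k a] assms by (simp add: klein_quot_def)

lemma of_int_div_11_Ints_iff: "real_of_int x / 11 \<in> \<int> \<longleftrightarrow> 11 dvd x"
proof
  assume "real_of_int x / 11 \<in> \<int>"
  then obtain n where "real_of_int x / 11 = of_int n" by (elim Ints_cases)
  then have "real_of_int x = of_int (11 * n)" by simp
  then have "x = 11 * n" by (simp only: of_int_eq_iff)
  then show "11 dvd x" by simp
qed (auto elim!: dvdE)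

lemma frac_of_int_div_11: "frac (real_of_int z / 11) = of_int (z mod 11) / 11"
proof -
  have "real_of_int z = 11 * of_int (z div 11) + of_int (z mod 11)"
    by (metis mult_div_mod_eq of_int_add of_int_mult of_int_numeral)
  then have "real_of_int z / 11 - of_int (z mod 11) / 11 = of_int (z div 11)"
    by (simp add: field_simps)
  moreover have "0 \<le> (of_int (z mod 11) / 11 :: real)" "(of_int (z mod 11) / 11 :: real) < 1"
    by simp_all
  ultimately show ?thesis by (simp only: frac_unique_iff Ints_of_int simp_thms)
qed

lemma dvd_11_mult_iff:
  fixes x :: int
  assumes "j \<in> {1..5::nat}"
  shows "11 dvd int j * x \<longleftrightarrow> 11 dvd x"
proof -
  have "j \<in> {1, 2, 3, 4, 5}" using assms by auto
  then show ?thesis by (elim insertE; simp; presburger)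
qed

lemma klein_torsion_nonzero:
  assumes "\<not> (11 dvd x \<and> 11 dvd y)" "j \<in> {1..5::nat}" "Im \<tau> > 0"
  shows "klein (of_int (int j * x) / 11) (of_int (int j * y) / 11) \<tau> \<noteq> 0"
  using assms by (intro klein_nonzero) (auto simp only: of_int_div_11_Ints_iff dvd_11_mult_iff)

lemma klein_quot_nonzero:
  assumes "\<not> (11 dvd x \<and> 11 dvd y)" "Im \<tau> > 0"
  shows "klein_quot s a x y \<tau> \<noteq> 0"
  using assms klein_torsion_nonzero[OF assms(1) _ assms(2)] eta_sq_nonzero[OF assms(2)]
  by (auto simp: klein_quot_def)

text \<open>
The order of \<open>klein_quot s a x y\<close> at infinity, for \<open>x\<close> and \<open>y\<close> not both divisible by \<open>11\<close>; it does
not depend on \<open>y\<close>. For a theta quotient, the cusps above \<open>\<infinity>\<close> correspond to \<open>x = 1, \<dots>, 5\<close>, and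
those above \<open>0\<close> to \<open>x = 0\<close>.
\<close>
definition cusp_order :: "int \<Rightarrow> (nat \<Rightarrow> int) \<Rightarrow> int \<Rightarrow> real" where
  "cusp_order s a x = of_int s / 12 - of_int (\<Sum>j=1..5. a j * ((int j * x mod 11) * (11 - int j * x mod 11))) / 242"

lemma qorder_klein_quot:
  assumes "\<not> (11 dvd x \<and> 11 dvd y)"
  shows "qorder (klein_quot s a x y) (cusp_order s a x)"
proof -
  have "qorder (klein (of_int (int j * x) / 11) (of_int (int j * y) / 11))
     (- of_int ((int j * x mod 11) * (11 - int j * x mod 11)) / 242)" if j: "j \<in> {1..5}" for j
  proof -
    have "frac (of_int (int j * x) / 11 :: real) = of_int (int j * x mod 11) / 11"
      by (rule frac_of_int_div_11)
    moreover have "qorder (klein (of_int (int j * x) / 11) (of_int (int j * y) / 11))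
      ((frac (of_int (int j * x) / 11) ^ 2 - frac (of_int (int j * x) / 11)) / 2)"
      using assms j by (intro qorder_klein) (auto simp only: of_int_div_11_Ints_iff dvd_11_mult_iff)
    moreover have "((of_int r / 11) ^ 2 - of_int r / 11) / 2 = (- of_int (r * (11 - r)) / 242 :: real)" for r
      by (simp add: field_simps power2_eq_square)
    ultimately show ?thesis by (simp only:)
  qed
  then have "qorder (\<lambda>\<tau>. eta_sq \<tau> powi s *
     (\<Prod>j=1..5. klein (of_int (int j * x) / 11) (of_int (int j * y) / 11) \<tau> powi a j))
     (of_int s * (1 / 12) + (\<Sum>j=1..5. of_int (a j) * (- of_int ((int j * x mod 11)
         * (11 - int j * x mod 11)) / 242)))"
    by (intro qorder_mult qorder_prod qorder_power_int qorder_eta_sq) auto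
  moreover have "of_int s * (1 / 12) + (\<Sum>j=1..5. of_int (a j) * (- of_int ((int j * x mod 11)
      * (11 - int j * x mod 11)) / 242))
     = cusp_order s a x"
    by (simp add: cusp_order_def sum_divide_distrib sum_negf)
  ultimately show ?thesis unfolding klein_quot_def [abs_def] by simp
qed

lemma norm_klein_quot_modular:
  fixes A B C D :: int
  assumes det: "A * D - B * C = 1" and tau: "Im \<tau> > 0"
  shows "norm (klein_quot s a x y ((of_int A * \<tau> + of_int B) / (of_int C * \<tau> + of_int D))) =
    norm (of_int C * \<tau> + of_int D) powi (s - (\<Sum>j=1..5. a j)) * norm (klein_quot s a (x * A + y * C) (x * B +
        y * D) \<tau>)"
proof -
  define J where "J = of_int C * \<tau> + of_int D"
  have J: "norm J \<noteq> 0" using Im_moebius_pos[OF det tau] by (simp add: J_def)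
  have K: "klein (of_int (int j * x) / 11) (of_int (int j * y) / 11) ((of_int A * \<tau> + of_int B) / J) = 
     klein (of_int (int j * (x * A + y * C)) / 11) (of_int (int j * (x * B + y * D)) / 11) \<tau> / J" for j
    unfolding J_def klein_modular[OF det tau] by (simp add: add_divide_distrib algebra_simps)
  have "norm (klein_quot s a x y ((of_int A * \<tau> + of_int B) / J)) = 
     norm J powi s * norm (eta_sq \<tau>) powi s * ((\<Prod>j=1..5. norm (klein (of_int (int j
         * (x * A + y * C)) / 11) (of_int (int j * (x * B + y * D)) / 11) \<tau>) powi a j)
       / (\<Prod>j=1..5. norm J powi a j))"
    unfolding klein_quot_def K norm_mult norm_power_int prod_norm[symmetric] norm_divide power_int_divide_distrib prod_dividef
    unfolding J_def eta_sq_modular(2)[OF det tau] power_int_mult_distrib ..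
  also have "(\<Prod>j=1..5. norm J powi a j) = norm J powi (\<Sum>j=1..5. a j)"
    by (rule prod_power_int_sum[OF J])
  finally show ?thesis
    unfolding J_def[symmetric] using J
    by (simp add: klein_quot_def norm_mult norm_power_int prod_norm[symmetric] power_int_diff)
qed

text \<open>
Holomorphy at the cusp \<open>A \<infinity>\<close>. Let \<open>(\<alpha>, \<beta>; \<gamma>, \<delta>)\<close> be the entries of \<open>A\<close>. Multiplication by \<open>11\<close>
after \<open>A\<close> is given by a matrix of determinant \<open>11\<close>. It factors into an element of \<open>SL\<^sub>2(\<int>)\<close> after
\<open>\<tau> \<mapsto> 11 \<tau>\<close> if \<open>11 dvd \<gamma>\<close>, and after \<open>\<tau> \<mapsto> (\<tau> + x) / 11\<close> otherwise, where \<open>x\<close> solves \<open>\<gamma> x = \<delta>\<close>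
modulo \<open>11\<close>.
\<close>
lemma slash_bounded_iff:
  assumes A: "A \<in> SL2Z"
  shows "bounded_at_ii_inf (slash k A (theta_quotient 11 (2 * k) a)) \<longleftrightarrow>
     cusp_order (int k + (\<Sum>j=1..5. a j)) a (if 11 dvd A$2$1 then A$1$1 else 0) \<ge> 0"
proof -
  define s where "s = int k + (\<Sum>j=1..5. a j)"
  have s: "s - (\<Sum>j=1..5. a j) = int k" by (simp add: s_def)
  define \<alpha> \<beta> \<gamma> \<delta> where "\<alpha> = A$1$1" and "\<beta> = A$1$2" and "\<gamma> = A$2$1" and "\<delta> = A$2$2"
  have det: "\<alpha> * \<delta> - \<beta> * \<gamma> = 1"
    using A by (simp add: SL2Z_def det_2 \<alpha>_def \<beta>_def \<gamma>_def \<delta>_def)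
  have slash: "norm (slash k A (theta_quotient 11 (2 * k) a) \<tau>) = 
     norm (klein_quot s a 1 0 (11 * ((of_int \<alpha> * \<tau> + of_int \<beta>) / (of_int \<gamma> * \<tau> + of_int \<delta>))))
         / norm (of_int \<gamma> * \<tau> + of_int \<delta>) ^ k"
    if "Im \<tau> > 0" for \<tau>
    using theta_quotient_11[OF Im_moebius_pos(1)[OF det that]]
    by (simp add: slash_def moebius_def norm_divide norm_power s_def \<alpha>_def \<beta>_def \<gamma>_def \<delta>_def)
  have J: "norm (of_int \<gamma> * \<tau> + of_int \<delta>) \<noteq> 0" if "Im \<tau> > 0" for \<tau>
    using Im_moebius_pos[OF det that] by simp
  show ?thesis
  proof (cases "11 dvd \<gamma>")
    case True
    then obtain c where c: "\<gamma> = 11 * c" by auto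
    have det': "\<alpha> * \<delta> - (11 * \<beta>) * c = 1" using det c by simp
    have "\<not> 11 dvd \<alpha>"
    proof
      assume "11 dvd \<alpha>"
      then have "11 dvd \<alpha> * \<delta> - (11 * \<beta>) * c" by (simp add: mult.assoc)
      with det' show False by simp
    qed
    then have "qorder (klein_quot s a \<alpha> (11 * \<beta>)) (cusp_order s a \<alpha>)"
      by (intro qorder_klein_quot) auto
    then have "bounded_at_ii_inf (slash k A (theta_quotient 11 (2 * k) a)) \<longleftrightarrow> cusp_order s a \<alpha> \<ge> 0"
    proof (rule bounded_at_ii_inf_iff_qorder[where h = 11 and K = 1 and x = 0])
      fix \<tau> assume tau: "Im \<tau> > 0"
      then have t11: "Im (11 * \<tau>) > 0" by simp
      have E1: "11 * ((of_int \<alpha> * \<tau> + of_int \<beta>) / (of_int \<gamma> * \<tau> + of_int \<delta>)) =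
          (of_int \<alpha> * (11 * \<tau>) + of_int (11 * \<beta>)) / (of_int c * (11 * \<tau>) + of_int \<delta>)"
        by (simp add: c algebra_simps)
      have E2: "of_int \<gamma> * \<tau> + of_int \<delta> = of_int c * (11 * \<tau>) + of_int \<delta>"
        by (simp add: c)
      show "norm (slash k A (theta_quotient 11 (2 * k) a) \<tau>) =
          1 * norm (klein_quot s a \<alpha> (11 * \<beta>) (of_real 11 * \<tau> + of_real 0))"
        using J[OF tau] unfolding slash[OF tau] E1
        unfolding norm_klein_quot_modular[OF det' t11] s E2 by simp
    qed auto
    then show ?thesis using True by (simp add: s_def \<alpha>_def \<gamma>_def)
  next
    case False
    have "coprime \<gamma> 11"
      using False prime_imp_coprime[of "11::int" \<gamma>] by (simp add: coprime_commute)
    then obtain i where "[\<gamma> * i = 1] (mod 11)"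
      using cong_solve_coprime_int by blast
    then have "[\<gamma> * (i * \<delta>) = \<delta>] (mod 11)"
      using cong_scalar_right[of "\<gamma> * i" 1 11 \<delta>] by (simp add: mult.assoc)
    then have "11 dvd \<delta> - \<gamma> * (i * \<delta>)"
      by (metis cong_iff_dvd_diff cong_sym)
    then obtain w where w: "\<delta> = \<gamma> * (i * \<delta>) + 11 * w" by (auto elim!: dvdE simp: algebra_simps)
    define x where "x = i * \<delta>"
    define y where "y = \<beta> - \<alpha> * x"
    have d: "\<delta> = \<gamma> * x + 11 * w" using w by (simp add: x_def)
    have b: "\<beta> = \<alpha> * x + y" by (simp add: y_def)
    have det': "(11 * \<alpha>) * w - y * \<gamma> = 1" using det unfolding d b by (simp add: algebra_simps)
    have "\<not> 11 dvd y"
    proof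
      assume "11 dvd y"
      then have "11 dvd (11 * \<alpha>) * w - y * \<gamma>" by (simp add: mult.assoc)
      with det' show False by simp
    qed
    then have "qorder (klein_quot s a (11 * \<alpha>) y) (cusp_order s a (11 * \<alpha>))"
      by (intro qorder_klein_quot) auto
    then have "bounded_at_ii_inf (slash k A (theta_quotient 11 (2 * k) a)) \<longleftrightarrow> cusp_order s a (11 * \<alpha>) \<ge> 0"
    proof (rule bounded_at_ii_inf_iff_qorder[where h = "1 / 11" and K = "1 / 11 ^ k" and x = "of_int x / 11"])
      fix \<tau> assume tau: "Im \<tau> > 0"
      define t where "t = (\<tau> + of_int x) / 11"
      have t: "Im t > 0" using tau by (simp add: t_def)
      have tau_t: "\<tau> = 11 * t - of_int x" using arg_cong[of _ _ "\<lambda>z. z - of_int x"] by (simp add: t_def add_divide_distrib)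
      have J': "of_int \<gamma> * \<tau> + of_int \<delta> = 11 * (of_int \<gamma> * t + of_int w)"
        by (simp add: tau_t d algebra_simps)
      have E1: "11 * ((of_int \<alpha> * \<tau> + of_int \<beta>) / (of_int \<gamma> * \<tau> + of_int \<delta>)) =
          (of_int (11 * \<alpha>) * t + of_int y) / (of_int \<gamma> * t + of_int w)"
      proof -
        have "of_int \<alpha> * \<tau> + of_int \<beta> = of_int (11 * \<alpha>) * t + of_int y"
          by (simp add: tau_t b algebra_simps)
        then show ?thesis
          unfolding J' by (simp only: times_divide_eq_right mult_divide_mult_cancel_left_if) simp
      qed
      show "norm (slash k A (theta_quotient 11 (2 * k) a) \<tau>) =
          1 / 11 ^ k * norm (klein_quot s a (11 * \<alpha>) y (of_real (1 / 11) * \<tau> + of_real (of_int x / 11)))"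
      proof -
        define r where "r = norm (of_int \<gamma> * t + of_int w)"
        have "r \<noteq> 0" using Im_moebius_pos(2)[OF det' t] by (simp add: r_def)
        moreover have "of_real (1 / 11) * \<tau> + of_real (of_int x / 11) = t"
          by (simp add: t_def add_divide_distrib)
        ultimately show ?thesis
          unfolding slash[OF tau] E1
          unfolding norm_klein_quot_modular[OF det' t] s J' norm_mult r_def[symmetric]
          by (simp add: power_mult_distrib)
      qed
    qed auto
    moreover have "cusp_order s a (11 * \<alpha>) = cusp_order s a 0"
      by (simp add: cusp_order_def mult.left_commute[of _ 11])
    ultimately show ?thesis using False by (simp add: s_def \<gamma>_def)
  qed
qed

section \<open>The modularity criterion for level 11\<close>

lemma theta_quotient_plus_1:
  "theta_quotient N a0 a (\<tau> + 1) =
     ee (of_real (real N / 24 * of_int (S1 N a0 a) - 1 / (2 * real N) * of_int (S2 N a))) * theta_quotient N a0 a \<tau>"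
proof -
  have 1: "qpow (real n) (\<tau> + 1) = qpow (real n) \<tau>" for n
    using ee_of_int[of "int n"] by (simp add: qpow_eq_ee distrib_left ee_add)
  have 2: "qpow r (\<tau> + 1) = ee (of_real r) * qpow r \<tau>" for r
    by (simp add: qpow_eq_ee distrib_left ee_add)
  show ?thesis unfolding theta_quotient_def 1 unfolding 2 by simp
qed

lemma sum_1_5: "(\<Sum>j=1..5::nat. f j) = f 1 + f 2 + f 3 + f 4 + (f 5 :: int)"
  by (simp add: numeral_eq_Suc)

lemma translation_invariant_imp_dvd:
  assumes "theta_quotient 11 (2 * k) a (\<tau> + 1) = theta_quotient 11 (2 * k) a \<tau>" "Im \<tau> > 0"
  shows "11 dvd (\<Sum>j=1..5. int j ^ 2 * a j)" "6 dvd int k + (\<Sum>j=1..5. a j)"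
proof -
  define s where "s = int k + (\<Sum>j=1..5. a j)"
  define Q where "Q = (\<Sum>j=1..5. int j ^ 2 * a j)"
  define P where "P = (\<Sum>j=1..5. int j * a j)"
  have S: "S1 11 (2 * k) a = 2 * s" "S2 11 a = 11 * P - Q"
    by (simp_all add: S1_def S2_def s_def Q_def P_def sum_1_5 del: One_nat_def)
  have "theta_quotient 11 (2 * k) a \<tau> \<noteq> 0"
    unfolding theta_quotient_11[OF assms(2)] using assms(2) by (intro klein_quot_nonzero) auto
  then have "ee (of_real (real 11 / 24 * of_int (2 * s) - 1 / (2 * real 11) * of_int (11 * P - Q))) = 1"
    using assms(1) unfolding theta_quotient_plus_1 S by simp
  then obtain R :: int where "complex_of_real (real 11 / 24 * of_int (2 * s) - 1 / (2 * real 11) *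
      of_int (11 * P - Q)) = of_real (of_int R)"
    unfolding ee_eq_1_iff by auto
  then have "real 11 / 24 * of_int (2 * s) - 1 / (2 * real 11) * of_int (11 * P - Q) = of_int R"
    by (simp only: of_real_eq_iff)
  then have "real_of_int (121 * s - 6 * (11 * P - Q)) = of_int (132 * R)"
    by (simp add: field_simps)
  then have "121 * s - 6 * (11 * P - Q) = 132 * R" by (simp only: of_int_eq_iff)
  then have "Q = 11 * (2 * (12 * R - 11 * s + 6 * P) - Q)" "s = 6 * (22 * R + 11 * P - Q - 20 * s)"
    by simp_all
  then have "11 dvd Q" "6 dvd s" using dvd_triv_left by metis+
  then show "11 dvd (\<Sum>j=1..5. int j ^ 2 * a j)" "6 dvd int k + (\<Sum>j=1..5. a j)"
    by (simp_all only: Q_def s_def)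
qed

lemma klein_quot_lower:
  assumes "Im \<tau> > 0"
  shows "klein_quot (6 * t) a 1 0 (\<tau> / (\<tau> + 1)) =
     (-1) powi t * (\<tau> + 1) powi (6 * t - (\<Sum>j=1..5. a j)) * klein_quot (6 * t) a 1 0 \<tau>"
proof -
  have det: "(1::int) * 1 - 0 * 1 = 1" by simp
  have J: "\<tau> + 1 \<noteq> 0" using Im_moebius_pos[OF det assms] by simp
  have K: "klein u 0 (\<tau> / (\<tau> + 1)) = klein u 0 \<tau> / (\<tau> + 1)" for u
    using klein_modular[OF det assms, of u 0] by simp
  have "eta_sq (\<tau> / (\<tau> + 1)) powi (6 * t) = (eta_sq (\<tau> / (\<tau> + 1)) ^ 6) powi t"
    by (simp add: power_int_mult)
  also have "\<dots> = ((-1) * (\<tau> + 1) ^ 6 * eta_sq \<tau> ^ 6) powi t"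
    unfolding eta_sq_6_lower[OF assms] by simp
  also have "\<dots> = (-1) powi t * (\<tau> + 1) powi (6 * t) * eta_sq \<tau> powi (6 * t)"
    unfolding power_int_mult_distrib by (simp add: power_int_mult)
  finally have E: "eta_sq (\<tau> / (\<tau> + 1)) powi (6 * t) = \<dots>" .
  have "klein_quot (6 * t) a 1 0 (\<tau> / (\<tau> + 1)) = (-1) powi t * (\<tau> + 1) powi (6 * t) * eta_sq \<tau> powi (6 * t) *
     ((\<Prod>j=1..5. klein (of_int (int j * 1) / 11) (of_int (int j * 0) / 11) \<tau> powi a j) / (\<Prod>j=1..5. (\<tau> + 1) powi a j))"
    unfolding klein_quot_def E by (simp add: K power_int_divide_distrib prod_dividef)
  also have "(\<Prod>j=1..5. (\<tau> + 1) powi a j) = (\<tau> + 1) powi (\<Sum>j=1..5. a j)"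
    by (rule prod_power_int_sum[OF J])
  finally show ?thesis using J by (simp add: klein_quot_def power_int_diff)
qed

text \<open>
Invariance under \<open>\<Gamma>\<^sub>1(11)\<close>, after conjugation by \<open>\<tau> \<mapsto> 11 \<tau>\<close>. The Klein forms contribute a root of
unity \<open>e(x/2)\<close>. The condition on \<open>\<Sum> j\<^sup>2 a\<^sub>j\<close> makes \<open>x\<close> an integer, and \<open>x\<close> is even because the
entries \<open>1 + 11 A\<close> and \<open>11 B\<close> of the matrix cannot both be even.
\<close>
lemma klein_quot_Gamma1:
  fixes A B C D :: int
  assumes det: "(1 + 11 * A) * D - (11 * B) * C = 1" and tau: "Im \<tau> > 0"
    and Q: "11 dvd (\<Sum>j=1..5. int j ^ 2 * a j)"
  defines "J \<equiv> of_int C * \<tau> + of_int D"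
  shows "klein_quot (12 * n) a 1 0 ((of_int (1 + 11 * A) * \<tau> + of_int (11 * B)) / J) =
     J powi (12 * n - (\<Sum>j=1..5. a j)) * klein_quot (12 * n) a 1 0 \<tau>"
proof -
  have J: "J \<noteq> 0" using Im_moebius_pos[OF det tau] by (simp add: J_def)
  define \<tau>' where "\<tau>' = (of_int (1 + 11 * A) * \<tau> + of_int (11 * B)) / J"
  define e where "e = (\<lambda>j. complex_of_real (of_int (int j * A + int j * B + int j * A
      * (int j * B)) + real j / 11 * of_int (int j * B)) / 2)"
  have K: "klein (of_int (int j * 1) / 11) (of_int (int j * 0) / 11) \<tau>' =
     ee (e j) * klein (of_int (int j * 1) / 11) (of_int (int j * 0) / 11) \<tau> / J" for j :: nat
  proof -
    have "klein (real j / 11) 0 \<tau>' = klein (real j / 11 + of_int (int j * A)) (0 + of_int (int j * B)) \<tau> / J"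
      unfolding \<tau>'_def J_def klein_modular[OF det tau] by (simp add: add_divide_distrib algebra_simps)
    also have "klein (real j / 11 + of_int (int j * A)) (0 + of_int (int j * B)) \<tau> =
        ee (e j) * klein (real j / 11) 0 \<tau>"
      unfolding klein_plus_int[OF tau] e_def by simp
    finally show ?thesis by simp
  qed
  have "eta_sq \<tau>' powi (12 * n) = (eta_sq \<tau>' ^ 12) powi n"
    by (simp add: power_int_mult)
  also have "\<dots> = J powi (12 * n) * eta_sq \<tau> powi (12 * n)"
    unfolding \<tau>'_def J_def eta_sq_modular(1)[OF det tau] power_int_mult_distrib by (simp add: power_int_mult)
  finally have E: "eta_sq \<tau>' powi (12 * n) = \<dots>" .
  have one: "(\<Prod>j=1..5. ee (e j) powi a j) = 1"
  proof -
    define P where "P = (\<Sum>j=1..5. int j * a j)"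
    obtain q where q: "(\<Sum>j=1..5. int j ^ 2 * a j) = 11 * q" using Q by (elim dvdE)
    have "even (11 * q - P)"
      unfolding q[symmetric] P_def sum_1_5 by simp
    then have par: "even q \<longleftrightarrow> even P" by presburger
    have "(\<Sum>j=1..5. of_int (a j) * e j) = complex_of_int (P * A + P * B + 11 * q * (A * B) + q * B) / 2"
    proof -
      have "2 * (\<Sum>j=1..5. of_int (a j) * e j) = complex_of_int (P * A + P * B + (\<Sum>j=1..5. int j ^ 2 * a j) * (A * B))
        + complex_of_int (\<Sum>j=1..5. int j ^ 2 * a j) * of_int B / 11"
        unfolding P_def e_def by (simp add: sum_distrib_left sum_distrib_right sum_divide_distrib flip: sum.distrib)
           (intro sum.cong refl, simp add: field_simps power2_eq_square)
      then show ?thesis unfolding q by (simp add: field_simps)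
    qed
    moreover have "even (P * A + P * B + 11 * q * (A * B) + q * B)"
    proof -
      have "odd ((1 + 11 * A) * D - (11 * B) * C)" using det by simp
      then have "even A \<or> odd B" by auto
      then show ?thesis using par by auto
    qed
    then obtain m where "P * A + P * B + 11 * q * (A * B) + q * B = 2 * m" by (elim evenE)
    ultimately have "(\<Sum>j=1..5. of_int (a j) * e j) = of_int m" by simp
    then show ?thesis
      unfolding ee_power_int ee_sum[symmetric] by (simp only: ee_of_int)
  qed
  have "klein_quot (12 * n) a 1 0 \<tau>' = J powi (12 * n) * eta_sq \<tau> powi (12 * n) *
     ((\<Prod>j=1..5. ee (e j) powi a j) *
      (\<Prod>j=1..5. klein (of_int (int j * 1) / 11) (of_int (int j * 0) / 11) \<tau> powi a j) / (\<Prod>j=1..5. J powi a j))"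
    unfolding klein_quot_def E K by (simp only: power_int_divide_distrib power_int_mult_distrib
        prod_dividef prod.distrib)
  also have "(\<Prod>j=1..5. J powi a j) = J powi (\<Sum>j=1..5. a j)"
    by (rule prod_power_int_sum[OF J])
  finally show ?thesis using J unfolding \<tau>'_def one by (simp add: klein_quot_def power_int_diff)
qed

lemma holomorphic_theta_quotient_11: "theta_quotient 11 (2 * k) a holomorphic_on upper_half_plane"
proof (rule holomorphic_transform)
  have mult: "(\<lambda>\<tau>. 11 * \<tau>) ` upper_half_plane \<subseteq> upper_half_plane"
    by (auto simp: upper_half_plane_def)
  have comp: "(\<lambda>\<tau>. f (11 * \<tau>)) holomorphic_on upper_half_plane" if "f holomorphic_on upper_half_plane" for f
    using holomorphic_on_compose_gen[of "\<lambda>\<tau>. 11 * \<tau>" upper_half_plane f upper_half_plane] that mult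
    by (auto simp: o_def intro!: holomorphic_intros)
  show "(\<lambda>\<tau>. klein_quot (int k + (\<Sum>j=1..5. a j)) a 1 0 (11 * \<tau>)) holomorphic_on upper_half_plane"
    unfolding klein_quot_def using klein_torsion_nonzero[of 1 0]
    by (intro holomorphic_intros comp holomorphic_eta_sq holomorphic_klein)
       (auto simp: upper_half_plane_def eta_sq_nonzero)
  show "klein_quot (int k + (\<Sum>j=1..5. a j)) a 1 0 (11 * \<tau>) =
      theta_quotient 11 (2 * k) a \<tau>" if "\<tau> \<in> upper_half_plane" for \<tau>
    using that theta_quotient_11 by (simp add: upper_half_plane_def)
qed

text \<open>The integral matrix with rows \<open>(a, b)\<close> and \<open>(c, d)\<close>.\<close>
definition mat2 :: "int \<Rightarrow> int \<Rightarrow> int \<Rightarrow> int \<Rightarrow> int^2^2" where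
  "mat2 a b c d = (\<chi> i j. if i = 1 then (if j = 1 then a else b) else (if j = 1 then c else d))"

lemma mat2_nth [simp]: "mat2 a b c d $ 1 $ 1 = a" "mat2 a b c d $ 1 $ 2 = b"
   "mat2 a b c d $ 2 $ 1 = c" "mat2 a b c d $ 2 $ 2 = d"
  by (simp_all add: mat2_def)

lemma mat2_SL2Z: "mat2 a b c d \<in> SL2Z \<longleftrightarrow> a * d - b * c = 1"
  by (simp add: SL2Z_def det_2)

lemma cusp_order_mod: "cusp_order s a x = cusp_order s a (x mod 11)"
  by (simp add: cusp_order_def mod_mult_right_eq)

lemma cusp_order_0: "cusp_order s a 0 = of_int s / 12"
  by (simp add: cusp_order_def)

lemma cusp_order_reflect: "cusp_order s a (11 - x) = cusp_order s a x"
proof -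
  have "(int j * (11 - x) mod 11) * (11 - int j * (11 - x) mod 11) =
      (int j * x mod 11) * (11 - int j * x mod 11)" for j
  proof -
    define y where "y = int j * x"
    have "int j * (11 - x) = - y + 11 * int j" by (simp add: y_def algebra_simps)
    then have "int j * (11 - x) mod 11 = (- y) mod 11" by (simp only: mod_mult_self2)
    moreover have "(- y) mod 11 = (if y mod 11 = 0 then 0 else 11 - y mod 11)"
      by (rule zmod_zminus1_eq_if)
    ultimately show ?thesis by (simp add: y_def)
  qed
  then show ?thesis by (simp add: cusp_order_def)
qed

lemma cusp_order_nonneg:
  assumes "\<And>x. x \<in> {1..5} \<Longrightarrow> cusp_order s a x \<ge> 0" "\<not> 11 dvd x"
  shows "cusp_order s a x \<ge> 0"
proof -
  have "x mod 11 \<in> {1..10}" using assms(2) by (auto simp: dvd_eq_mod_eq_0)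
  then have "x mod 11 \<in> {1..5} \<or> 11 - x mod 11 \<in> {1..5}" by auto
  then show ?thesis
    using assms(1) cusp_order_reflect[of s a "x mod 11"] cusp_order_mod[of s a x] by metis
qed

text \<open>
The modularity criterion. The conditions are necessary by the two parabolic elements \<open>(1, 1; 0,
1)\<close> and \<open>(1, 0; 11, 1)\<close> and by the growth at one cusp above \<open>0\<close> and at the five cusps above \<open>\<infinity>\<close>.
\<close>
theorem theta_quotient_11_modular_iff:
  defines "s \<equiv> \<lambda>k a. int k + (\<Sum>j=1..5. a j)"
  shows "theta_quotient 11 (2 * k) a \<in> modular_forms k (Gamma1 11) \<longleftrightarrow>
     12 dvd s k a \<and> 0 \<le> s k a \<and> 11 dvd (\<Sum>j=1..5. int j ^ 2 * a j) \<and> (\<forall>x\<in>{1..5}. cusp_order (s k a) a x \<ge> 0)"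
proof (intro iffI conjI ballI)
  assume mf: "theta_quotient 11 (2 * k) a \<in> modular_forms k (Gamma1 11)"
  then have inv: "\<And>A \<tau>. A \<in> Gamma1 11 \<Longrightarrow> Im \<tau> > 0 \<Longrightarrow> slash k A (theta_quotient 11 (2 * k) a) \<tau> =
      theta_quotient 11 (2 * k) a \<tau>"
    and bdd: "\<And>A. A \<in> SL2Z \<Longrightarrow> cusp_order (s k a) a (if 11 dvd A$2$1 then A$1$1 else 0) \<ge> 0"
    using slash_bounded_iff[of _ k a] by (auto simp: modular_forms_def upper_half_plane_def s_def)
  have "mat2 1 1 0 1 \<in> Gamma1 11" by (simp add: Gamma1_def mat2_SL2Z cong_def)
  from inv[OF this, of "\<i>"] have T: "theta_quotient 11 (2 * k) a (\<i> + 1) = theta_quotient 11 (2 * k) a \<i>"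
    by (simp add: slash_def moebius_def)
  from translation_invariant_imp_dvd(1)[OF T]
  show "11 dvd (\<Sum>j=1..5. int j ^ 2 * a j)" by simp
  have s6: "6 dvd s k a"
    using translation_invariant_imp_dvd(2)[OF T] by (simp add: s_def)
  show "12 dvd s k a"
  proof -
    obtain t where t: "s k a = 6 * t" using s6 by (elim dvdE)
    have "mat2 1 0 11 1 \<in> Gamma1 11" by (simp add: Gamma1_def mat2_SL2Z cong_def)
    from inv[OF this, of "\<i>"] 
    have "theta_quotient 11 (2 * k) a (\<i> / (11 * \<i> + 1)) / (11 * \<i> + 1) ^ k = theta_quotient 11 (2 * k) a \<i>"
      by (simp add: slash_def moebius_def)
    moreover have "Im (\<i> / (11 * \<i> + 1)) > 0"
      using Im_moebius_pos(1)[of 1 1 0 11 "\<i>"] by simp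
    moreover have nz: "11 * \<i> + 1 \<noteq> 0" by (simp add: complex_eq_iff)
    moreover have k: "6 * t - (\<Sum>j=1..5. a j) = int k" using t by (simp add: s_def)
    moreover have "theta_quotient 11 (2 * k) a \<tau> = klein_quot (6 * t) a 1 0 (11 * \<tau>)" if "Im \<tau> > 0" for \<tau>
      using theta_quotient_11[OF that, of k a] t unfolding s_def by (simp only:)
    ultimately have "(-1) powi t * klein_quot (6 * t) a 1 0 (11 * \<i>) = klein_quot (6 * t) a 1 0 (11 * \<i>)"
      using klein_quot_lower[of "11 * \<i>" t a] by simp
    moreover have "klein_quot (6 * t) a 1 0 (11 * \<i>) \<noteq> 0" by (rule klein_quot_nonzero) auto
    ultimately have "even t" by (cases "even t") (auto simp: power_int_minus_left)
    then show ?thesis using t by auto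
  qed
  have "mat2 0 (-1) 1 0 \<in> SL2Z" by (simp add: mat2_SL2Z)
  from bdd[OF this] show "0 \<le> s k a" by (simp add: cusp_order_0)
  fix x :: int assume "x \<in> {1..5}"
  then consider "x = 1" | "x = 2" | "x = 3" | "x = 4" | "x = 5" by fastforce
  then show "cusp_order (s k a) a x \<ge> 0"
    using bdd[of "mat2 1 0 11 1"] bdd[of "mat2 2 1 11 6"] bdd[of "mat2 3 1 11 4"]
      bdd[of "mat2 4 1 11 3"] bdd[of "mat2 5 4 11 9"]
    by cases (simp_all add: mat2_SL2Z)
next
  assume *: "12 dvd s k a \<and> 0 \<le> s k a \<and> 11 dvd (\<Sum>j=1..5. int j ^ 2 * a j) \<and> (\<forall>x\<in>{1..5}. cusp_order (s k a) a x \<ge> 0)"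
  then obtain n where n: "s k a = 12 * n" by blast
  have k: "12 * n - (\<Sum>j=1..5. a j) = int k" using n by (simp add: s_def)
  have "slash k M (theta_quotient 11 (2 * k) a) \<tau> = theta_quotient 11 (2 * k) a \<tau>"
    if M: "M \<in> Gamma1 11" and tau: "Im \<tau> > 0" for M \<tau>
  proof -
    define \<alpha> \<beta> \<gamma> \<delta> where "\<alpha> = M$1$1" and "\<beta> = M$1$2" and "\<gamma> = M$2$1" and "\<delta> = M$2$2"
    have det: "\<alpha> * \<delta> - \<beta> * \<gamma> = 1" and "[\<alpha> = 1] (mod 11)" "11 dvd \<gamma>"
      using M by (simp_all add: Gamma1_def SL2Z_def det_2 \<alpha>_def \<beta>_def \<gamma>_def \<delta>_def cong_0_iff)
    then obtain A C where A: "\<alpha> = 1 + 11 * A" and C: "\<gamma> = 11 * C"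
      by (metis cong_iff_lin cong_sym dvdE mult.commute)
    have det': "(1 + 11 * A) * \<delta> - (11 * \<beta>) * C = 1" using det by (simp add: A C)
    have t11: "Im (11 * \<tau>) > 0" using tau by simp
    define J where "J = of_int C * (11 * \<tau>) + of_int \<delta>"
    have J: "J \<noteq> 0" using Im_moebius_pos(2)[OF det' t11] by (simp add: J_def)
    have J': "of_int \<gamma> * \<tau> + of_int \<delta> = J" by (simp add: J_def C)
    have E: "11 * ((of_int \<alpha> * \<tau> + of_int \<beta>) / J) = (of_int (1 + 11 * A) * (11 * \<tau>) + of_int (11 * \<beta>)) / J"
      by (simp add: A algebra_simps)
    have "theta_quotient 11 (2 * k) a ((of_int \<alpha> * \<tau> + of_int \<beta>) / J) = 
        klein_quot (12 * n) a 1 0 (11 * ((of_int \<alpha> * \<tau> + of_int \<beta>) / J))"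
      using theta_quotient_11[OF Im_moebius_pos(1)[OF det tau]] n by (simp add: J' s_def)
    also have "\<dots> = J powi int k * klein_quot (12 * n) a 1 0 (11 * \<tau>)"
      unfolding E using klein_quot_Gamma1[OF det' t11, of a n] * k by (simp add: J_def)
    also have "klein_quot (12 * n) a 1 0 (11 * \<tau>) = theta_quotient 11 (2 * k) a \<tau>"
      using theta_quotient_11[OF tau] n by (simp add: s_def)
    finally show ?thesis
      using J by (simp add: slash_def moebius_def \<alpha>_def [symmetric] \<beta>_def [symmetric] \<gamma>_def [symmetric] \<delta>_def [symmetric] J')
  qed
  moreover have "bounded_at_ii_inf (slash k A (theta_quotient 11 (2 * k) a))" if A: "A \<in> SL2Z" for A
  proof (cases "11 dvd A$2$1")
    case True
    have "\<not> 11 dvd A$1$1"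
    proof
      assume "11 dvd A$1$1"
      then have "11 dvd A$1$1 * A$2$2 - A$1$2 * A$2$1" using True by simp
      then show False using A by (simp add: SL2Z_def det_2)
    qed
    then show ?thesis
      using slash_bounded_iff[OF A, of k a] True * cusp_order_nonneg[of "s k a" a] by (simp add: s_def)
  next
    case False
    have "cusp_order (s k a) a 0 \<ge> 0" using * by (simp add: cusp_order_0)
    then show ?thesis using slash_bounded_iff[OF A, of k a] False by (simp only: s_def if_False)
  qed
  ultimately show "theta_quotient 11 (2 * k) a \<in> modular_forms k (Gamma1 11)"
    using holomorphic_theta_quotient_11 by (simp add: modular_forms_def upper_half_plane_def)
qed

section \<open>Counting cusp orders with fifth roots of unity\<close>

text \<open>The lists of \<open>d\<close> natural numbers with sum \<open>m\<close>; zero entries are allowed.\<close>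
definition compositions :: "nat \<Rightarrow> nat \<Rightarrow> nat list set" where
  "compositions d m = {p. length p = d \<and> sum_list p = m}"

text \<open>
The sum of the entries multiplied by their positions, where the positions are counted from the end
of the list and start at \<open>0\<close>.
\<close>
fun weight :: "nat list \<Rightarrow> nat" where
  "weight [] = 0"
| "weight (x # p) = x * length p + weight p"

lemma finite_compositions: "finite (compositions d m)"
proof (rule finite_subset)
  show "compositions d m \<subseteq> {p. set p \<subseteq> {..m} \<and> length p = d}"
    by (auto simp: compositions_def intro: member_le_sum_list)
qed (simp add: finite_lists_length_eq)

text \<open>
The complete homogeneous symmetric polynomial of degree \<open>m\<close> in \<open>d\<close> variables, evaluated at \<open>1, z,
\<dots>\<close>, the first \<open>d\<close> powers of \<open>z\<close>.
\<close>
definition weight_sum :: "complex \<Rightarrow> nat \<Rightarrow> nat \<Rightarrow> complex" where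
  "weight_sum z d m = (\<Sum>p\<in>compositions d m. z ^ weight p)"

lemma compositions_Suc:
  "compositions (Suc d) (Suc m) = (#) 0 ` compositions d (Suc m) \<union> (\<lambda>p. Suc (hd p) # tl p) ` compositions (Suc d) m"
proof (intro equalityI subsetI)
  fix p assume "p \<in> compositions (Suc d) (Suc m)"
  then obtain x r where p: "p = x # r" "length r = d" "x + sum_list r = Suc m"
    by (auto simp: compositions_def length_Suc_conv)
  show "p \<in> (#) 0 ` compositions d (Suc m) \<union> (\<lambda>p. Suc (hd p) # tl p) ` compositions (Suc d) m"
  proof (cases x)
    case 0
    then show ?thesis using p by (auto simp: compositions_def)
  next
    case (Suc y)
    then have "y # r \<in> compositions (Suc d) m" using p by (auto simp: compositions_def)
    then show ?thesis using p Suc by (auto intro!: image_eqI[of _ _ "y # r"])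
  qed
qed (auto simp: compositions_def length_Suc_conv)

lemma weight_sum_Suc: "weight_sum z (Suc d) (Suc m) = weight_sum z d (Suc m) + z ^ d * weight_sum z (Suc d) m"
proof -
  let ?A = "(#) 0 ` compositions d (Suc m)" and ?B = "(\<lambda>p. Suc (hd p) # tl p) ` compositions (Suc d) m"
  have "inj_on (\<lambda>p. Suc (hd p) # tl p) (compositions (Suc d) m)"
  proof (rule inj_onI)
    fix p r assume "p \<in> compositions (Suc d) m" "r \<in> compositions (Suc d) m" "Suc (hd p) # tl p = Suc (hd r) # tl r"
    then show "p = r" by (cases p; cases r) (simp_all add: compositions_def)
  qed
  then have "(\<Sum>p\<in>?B. z ^ weight p) = (\<Sum>p\<in>compositions (Suc d) m. z ^ weight (Suc (hd p) # tl p))"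
    by (rule sum.reindex_cong) auto
  also have "\<dots> = (\<Sum>p\<in>compositions (Suc d) m. z ^ d * z ^ weight p)"
    by (rule sum.cong) (auto simp: compositions_def length_Suc_conv power_add)
  finally have B: "(\<Sum>p\<in>?B. z ^ weight p) = z ^ d * weight_sum z (Suc d) m"
    by (simp add: weight_sum_def sum_distrib_left)
  have "(\<Sum>p\<in>?A. z ^ weight p) = weight_sum z d (Suc m)"
    unfolding weight_sum_def by (rule sum.reindex_cong[of "(#) 0"]) auto
  moreover have "?A \<inter> ?B = {}" by auto
  ultimately show ?thesis
    unfolding weight_sum_def[of z "Suc d" "Suc m"] compositions_Suc
    using B by (subst sum.union_disjoint) (auto simp: finite_compositions)
qed

lemma weight_sum_0: "weight_sum z d 0 = 1"
proof -
  have "compositions d 0 = {replicate d 0}"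
    by (auto simp: compositions_def sum_list_eq_0_iff intro: replicate_eqI)
  moreover have "weight (replicate d 0) = 0" by (induction d) auto
  ultimately show ?thesis by (simp add: weight_sum_def)
qed

lemma weight_sum_empty: "weight_sum z 0 (Suc m) = 0"
  by (simp add: weight_sum_def compositions_def)

text \<open>
The generating function of \<open>weight_sum z 5\<close> is the inverse of the product of \<open>1 - z\<^sup>i X\<close> over \<open>i <
5\<close>. For a primitive fifth root of unity this product is \<open>1 - X\<^sup>5\<close>, so that \<open>weight_sum z 5\<close> has
period \<open>5\<close>.
\<close>
lemma weight_sum_5:
  assumes z: "1 + z + z ^ 2 + z ^ 3 + z ^ 4 = 0"
  shows "weight_sum z 5 (5 * m) = 1"
proof (induction m)
  case (Suc m)
  define k where "k = 5 * m"
  define V where "V = weight_sum z"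
  have rec: "V (Suc d) (Suc n) = V d (Suc n) + z ^ d * V (Suc d) n" for d n
    unfolding V_def by (rule weight_sum_Suc)
  have z5: "z ^ 5 = 1"
    using z by algebra
  define v where "v = (\<lambda>i. V 5 (k + i))"
  have V4: "V 4 (k + Suc i) = v (Suc i) - z ^ 4 * v i" for i
    using rec[of 4 "k + i"] by (simp add: v_def)
  have V3: "V 3 (k + Suc (Suc i)) = V 4 (k + Suc (Suc i)) - z ^ 3 * V 4 (k + Suc i)" for i
    using rec[of 3 "k + Suc i"] by simp
  have V2: "V 2 (k + Suc (Suc (Suc i))) = V 3 (k + Suc (Suc (Suc i))) - z ^ 2 * V 3 (k + Suc (Suc i))" for i
    using rec[of 2 "k + Suc (Suc i)"] by simp
  have V1: "V 1 (k + Suc (Suc (Suc (Suc i)))) = V 2 (k + Suc (Suc (Suc (Suc i)))) - z * V 2 (k +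
      Suc (Suc (Suc i)))" for i
    using rec[of 1 "k + Suc (Suc (Suc i))"] by (simp add: numeral_2_eq_2)
  have "V 1 (k + 5) = V 1 (k + 4)"
    using rec[of 0 "k + 4"] weight_sum_empty[of z "k + 4"] by (simp add: V_def numeral_eq_Suc)
  \<comment> \<open>the coefficients are the elementary symmetric polynomials in \<open>1, z, z\<^sup>2, z\<^sup>3, z\<^sup>4\<close>\<close>
  moreover have "V 1 (k + 5) - V 1 (k + 4) =
      v 5 - (1 + z + z ^ 2 + z ^ 3 + z ^ 4) * v 4
      + (z + z ^ 2 + 2 * z ^ 3 + 2 * z ^ 4 + 2 * z ^ 5 + z ^ 6 + z ^ 7) * v 3
      - (z ^ 3 + z ^ 4 + 2 * z ^ 5 + 2 * z ^ 6 + 2 * z ^ 7 + z ^ 8 + z ^ 9) * v 2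
      + (z ^ 6 + z ^ 7 + z ^ 8 + z ^ 9 + z ^ 10) * v 1 - z ^ 10 * v 0"
  proof -
    have V1': "V 1 (k + 4) = V 2 (k + 4) - z * V 2 (k + 3)" "V 1 (k + 5) = V 2 (k + 5) - z * V 2 (k + 4)"
      using V1[of 0] V1[of 1] by (simp_all add: numeral_eq_Suc)
    have V2': "V 2 (k + 3) = V 3 (k + 3) - z ^ 2 * V 3 (k + 2)" "V 2 (k + 4) = V 3 (k + 4) - z ^ 2 * V 3 (k + 3)"
       "V 2 (k + 5) = V 3 (k + 5) - z ^ 2 * V 3 (k + 4)"
      using V2[of 0] V2[of 1] V2[of 2] by (simp_all add: numeral_eq_Suc)
    have V3': "V 3 (k + 2) = V 4 (k + 2) - z ^ 3 * V 4 (k + 1)" "V 3 (k + 3) = V 4 (k + 3) - z ^ 3 * V 4 (k + 2)"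
       "V 3 (k + 4) = V 4 (k + 4) - z ^ 3 * V 4 (k + 3)" "V 3 (k + 5) = V 4 (k + 5) - z ^ 3 * V 4 (k + 4)"
      using V3[of 0] V3[of 1] V3[of 2] V3[of 3] by (simp_all add: numeral_eq_Suc)
    have V4': "V 4 (k + 1) = v 1 - z ^ 4 * v 0" "V 4 (k + 2) = v 2 - z ^ 4 * v 1" "V 4 (k + 3) = v 3 - z ^ 4 * v 2"
        "V 4 (k + 4) = v 4 - z ^ 4 * v 3" "V 4 (k + 5) = v 5 - z ^ 4 * v 4"
      using V4[of 0] V4[of 1] V4[of 2] V4[of 3] V4[of 4] by (simp_all add: numeral_eq_Suc)
    show ?thesis unfolding V1' V2' V3' V4' by algebra
  qed
  moreover have "z ^ 10 = 1" "z + z ^ 2 + 2 * z ^ 3 + 2 * z ^ 4 + 2 * z ^ 5 + z ^ 6 + z ^ 7 = 0"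
      "z ^ 3 + z ^ 4 + 2 * z ^ 5 + 2 * z ^ 6 + 2 * z ^ 7 + z ^ 8 + z ^ 9 = 0"
      "z ^ 6 + z ^ 7 + z ^ 8 + z ^ 9 + z ^ 10 = 0"
    using z by algebra+
  ultimately have "v 5 = v 0" using z by simp
  then show ?case using Suc.IH by (simp add: v_def V_def k_def add.commute)
qed (simp add: weight_sum_0)

lemma sum_fifth_roots:
  "(\<Sum>r<5. ee (1 / 5) ^ (r * e)) = (if 5 dvd e then 5 else 0)"
proof -
  define z where "z = ee (1 / 5) ^ e"
  have z1: "z = 1 \<longleftrightarrow> 5 dvd e"
  proof -
    have "z = 1 \<longleftrightarrow> (\<exists>n::int. complex_of_int (int e) = of_int (5 * n))"
      unfolding z_def ee_power ee_eq_1_iff by (simp add: field_simps)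
    also have "\<dots> \<longleftrightarrow> (5 :: int) dvd int e" unfolding of_int_eq_iff by (auto simp: dvd_def)
    also have "\<dots> \<longleftrightarrow> 5 dvd e" by presburger
    finally show ?thesis .
  qed
  have z5: "z ^ 5 = 1"
    unfolding z_def power_mult[symmetric] ee_power using ee_of_int[of "int e"] by simp
  have "(\<Sum>r<5. ee (1 / 5) ^ (r * e)) = (\<Sum>r<5. z ^ r)"
    by (simp add: z_def mult.commute flip: power_mult)
  also have "\<dots> = (if 5 dvd e then 5 else 0)"
    using z1 z5 geometric_sum[of z 5] by auto
  finally show ?thesis .
qed

lemma card_compositions_weight:
  "5 * card {p \<in> compositions 5 (5 * m). 5 dvd weight p + c} + 1 = (5 * m + 4 choose 4) + (if 5 dvd c then 5 else 0)"
proof -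
  define w where "w = ee (1 / 5)"
  let ?C = "compositions 5 (5 * m)"
  have fin: "finite ?C" by (rule finite_compositions)
  have inner: "(\<Sum>p\<in>?C. w ^ (r * (weight p + c))) = w ^ (r * c)" if "r \<in> {1..<5}" for r
  proof -
    have "\<not> 5 dvd r" using that by (auto dest: dvd_imp_le)
    then have "(\<Sum>i<5. w ^ (i * r)) = 0" using sum_fifth_roots[of r] by (simp add: w_def)
    then have "1 + w ^ r + (w ^ r) ^ 2 + (w ^ r) ^ 3 + (w ^ r) ^ 4 = 0"
      by (simp add: numeral_eq_Suc power_add mult_ac power_mult_distrib)
    from weight_sum_5[OF this, of m] have "(\<Sum>p\<in>?C. w ^ (r * weight p)) = 1"
      by (simp add: weight_sum_def power_mult)
    moreover have "(\<Sum>p\<in>?C. w ^ (r * (weight p + c))) = w ^ (r * c) * (\<Sum>p\<in>?C. w ^ (r * weight p))"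
      by (simp add: distrib_left power_add sum_distrib_left mult_ac)
    ultimately show ?thesis by simp
  qed
  have card: "card ?C = 5 * m + 4 choose 4"
  proof -
    have "card ?C = (5 * m + 5 - 1) choose (5 * m)"
      unfolding compositions_def by (rule card_length_sum_list)
    also have "\<dots> = 5 * m + 4 choose 4"
      using binomial_symmetric[of 4 "5 * m + 4"] by (simp add: add.commute)
    finally show ?thesis .
  qed
  have split: "(\<Sum>r<5. f r) = f 0 + (\<Sum>r=1..<5. f r)" for f :: "nat \<Rightarrow> complex"
    by (simp add: numeral_eq_Suc)
  have "complex_of_nat (5 * card {p \<in> ?C. 5 dvd weight p + c}) = (\<Sum>p\<in>?C. \<Sum>r<5. w ^ (r * (weight p + c)))"
    unfolding w_def sum_fifth_roots using fin by (simp add: sum.If_cases Int_def mult.commute)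
  also have "\<dots> = (\<Sum>r<5. \<Sum>p\<in>?C. w ^ (r * (weight p + c)))"
    by (rule sum.swap)
  also have "\<dots> = of_nat (card ?C) + (\<Sum>r=1..<5. w ^ (r * c))"
    unfolding split using inner by simp
  also have "(\<Sum>r=1..<5. w ^ (r * c)) = (if 5 dvd c then 5 else 0) - 1"
    using split[of "\<lambda>r. w ^ (r * c)"] sum_fifth_roots[of c] by (simp add: w_def algebra_simps)
  finally have "complex_of_nat (5 * card {p \<in> ?C. 5 dvd weight p + c} + 1) =
      of_nat ((5 * m + 4 choose 4) + (if 5 dvd c then 5 else 0))"
    unfolding card by simp
  then show ?thesis by (simp only: of_nat_eq_iff)
qed

text \<open>
The possible orders at the five cusps above \<open>\<infinity>\<close> of the modular theta quotients of weight \<open>k\<close>: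
their sum \<open>5 m\<close> is what the cusps above \<open>0\<close> leave of the total \<open>5 k\<close>, and their weight is
congruent to \<open>2 k + m\<close> modulo \<open>5\<close>.
\<close>
definition cusp_lists :: "nat \<Rightarrow> nat list set" where
  "cusp_lists k = (\<Union>m\<le>k. {p \<in> compositions 5 (5 * m). 5 dvd weight p + (3 * k + 4 * m)})"

lemma finite_cusp_lists: "finite (cusp_lists k)"
  unfolding cusp_lists_def by (intro finite_UN_I) (auto intro: finite_subset[OF _ finite_compositions])

lemma sum_binomial_4:
  "(\<Sum>m\<le>k. real (5 * m + 4 choose 4)) =
     125 * real k ^ 5 / 24 + 625 * real k ^ 4 / 24 + 375 * real k ^ 3 / 8 + 875 * real k ^ 2 / 24 +
         137 * real k / 12 + 1"
proof (induction k)
  case (Suc k)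
  have "24 * real (n + 4 choose 4) = (real n + 4) * (real n + 3) * (real n + 2) * (real n + 1)" for n
    using gbinomial_mult_fact[of 4 "real (n + 4)"] binomial_gbinomial[of "n + 4" 4, where 'a = real]
    by (simp add: numeral_eq_Suc fact_numeral algebra_simps)
  from this[of "5 * Suc k"] have "real (5 * Suc k + 4 choose 4) =
      (5 * real k + 9) * (5 * real k + 8) * (5 * real k + 7) * (5 * real k + 6) / 24"
    by (simp add: algebra_simps)
  then show ?case unfolding sum.atMost_Suc Suc.IH
    by (simp add: field_simps power_numeral_reduce) 
qed simp

lemma count_residue:
  "5 * (\<Sum>m\<le>k. if 5 dvd 3 * k + 4 * m then 1 else 0) = real k + 1 + 5 * E11 k"
proof (induction k rule: less_induct)
  case (less k)
  show ?case
  proof (cases "k < 5")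
    case True
    then consider "k = 0" | "k = 1" | "k = 2" | "k = 3" | "k = 4" by linarith
    then show ?thesis by cases (simp_all add: E11_def atMost_nat_numeral atMost_Suc)
  next
    case False
    then obtain l where k: "k = l + 5" by (metis add.commute le_add_diff_inverse not_less)
    have d: "5 dvd 3 * (l + 5) + 4 * m \<longleftrightarrow> 5 dvd 3 * l + 4 * m" for m :: nat by presburger
    have "{..k} = {..l} \<union> {l + 1, l + 2, l + 3, l + 4, l + 5}" by (auto simp: k)
    then have "(\<Sum>m\<le>k. if 5 dvd 3 * k + 4 * m then 1 else 0 :: real) =
       (\<Sum>m\<le>l. if 5 dvd 3 * l + 4 * m then 1 else 0)
           + (\<Sum>m\<in>{l + 1, l + 2, l + 3, l + 4, l + 5}. if 5 dvd 3 * l + 4 * m then 1 else 0)"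
      unfolding k d by (simp add: sum.union_disjoint)
    also have "(\<Sum>m\<in>{l + 1, l + 2, l + 3, l + 4, l + 5}. if 5 dvd 3 * l + 4 * m then 1 else 0 :: real) = 1"
    proof -
      have "l mod 5 = 0 \<or> l mod 5 = 1 \<or> l mod 5 = 2 \<or> l mod 5 = 3 \<or> l mod 5 = 4" by presburger
      moreover have "5 dvd 3 * l + 4 * (l + 1) \<longleftrightarrow> l mod 5 = 3" "5 dvd 3 * l + 4 * (l + 2) \<longleftrightarrow> l mod 5 = 1"
        "5 dvd 3 * l + 4 * (l + 3) \<longleftrightarrow> l mod 5 = 4" "5 dvd 3 * l + 4 * (l + 4) \<longleftrightarrow> l mod 5 = 2"
        "5 dvd 3 * l + 4 * (l + 5) \<longleftrightarrow> l mod 5 = 0" by presburger+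
      ultimately show ?thesis by (elim disjE) simp_all
    qed
    also have "E11 k = E11 l" by (simp add: E11_def k)
    ultimately show ?thesis using less.IH[of l] by (simp add: k algebra_simps)
  qed
qed

lemma card_cusp_lists:
  "real (card (cusp_lists k)) = 25 * real k ^ 5 / 24 + 125 * real k ^ 4 / 24 + 75 * real k ^ 3 / 8
      + 175 * real k ^ 2 / 24 + 137 * real k / 60 + 1 / 5 + E11 k"
proof -
  let ?N = "\<lambda>m. {p \<in> compositions 5 (5 * m). 5 dvd weight p + (3 * k + 4 * m)}"
  have "card (cusp_lists k) = (\<Sum>m\<le>k. card (?N m))"
    unfolding cusp_lists_def
    by (rule card_UN_disjoint) (auto simp: compositions_def intro: finite_subset[OF _ finite_compositions])
  then have "5 * real (card (cusp_lists k)) = (\<Sum>m\<le>k. real (5 * card (?N m)))"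
    by (simp add: sum_distrib_left)
  also have "\<dots> = (\<Sum>m\<le>k. real (5 * m + 4 choose 4) + (if 5 dvd 3 * k + 4 * m then 5 else 0) - 1)"
  proof (rule sum.cong)
    fix m
    have "real (5 * card (?N m) + 1) = real ((5 * m + 4 choose 4) + (if 5 dvd 3 * k + 4 * m then 5 else 0))"
      unfolding card_compositions_weight ..
    then show "real (5 * card (?N m)) = real (5 * m + 4 choose 4) + (if 5 dvd 3 * k + 4 * m then 5 else 0) - 1"
      by (simp split: if_splits)
  qed simp
  also have "\<dots> = (\<Sum>m\<le>k. real (5 * m + 4 choose 4)) + 5 * (\<Sum>m\<le>k. if 5 dvd 3 * k + 4 * m then 1 else 0) - (real k + 1)"
    by (simp add: sum.distrib sum_subtractf sum_distrib_left if_distrib[of "\<lambda>x. 5 * x"] cong: if_cong)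
  finally show ?thesis unfolding sum_binomial_4 count_residue by (simp add: field_simps)
qed

section \<open>Exponent vectors and cusp orders\<close>

text \<open>
The exponent vector \<open>a\<close> has order \<open>n\<close> at the cusps above \<open>0\<close> and orders \<open>o\<^sub>1, \<dots>, o\<^sub>5\<close> at those
above \<open>\<infinity>\<close>, where \<open>o\<^sub>x\<close> is \<open>11 * cusp_order (12 * n) a x\<close>. The coefficient of \<open>a\<^sub>j\<close> in the equation
for \<open>o\<^sub>x\<close> is \<open>r (11 - r) / 2\<close>, with \<open>r\<close> the residue of \<open>j x\<close> modulo \<open>11\<close>. The order of the entries
in the list is chosen such that the integrality condition becomes a condition on the \<open>weight\<close> of
the list.
\<close>
definition cusp_data :: "nat \<Rightarrow> (nat \<Rightarrow> int) \<Rightarrow> nat \<Rightarrow> nat list \<Rightarrow> bool" where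
  "cusp_data k a n p \<longleftrightarrow> (\<exists>o1 o2 o3 o4 o5. p = [o5, o3, o4, o2, o1] \<and>
     int k + (a 1 + a 2 + a 3 + a 4 + a 5) = 12 * int n \<and>
     11 * int o1 = 121 * int n - (5 * a 1 + 9 * a 2 + 12 * a 3 + 14 * a 4 + 15 * a 5) \<and>
     11 * int o2 = 121 * int n - (9 * a 1 + 14 * a 2 + 15 * a 3 + 12 * a 4 + 5 * a 5) \<and>
     11 * int o3 = 121 * int n - (12 * a 1 + 15 * a 2 + 9 * a 3 + 5 * a 4 + 14 * a 5) \<and>
     11 * int o4 = 121 * int n - (14 * a 1 + 12 * a 2 + 5 * a 3 + 15 * a 4 + 9 * a 5) \<and>
     11 * int o5 = 121 * int n - (15 * a 1 + 5 * a 2 + 14 * a 3 + 9 * a 4 + 12 * a 5))"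

lemma cusp_data_list:
  "cusp_data k a n [o5, o3, o4, o2, o1] \<longleftrightarrow>
     int k + (a 1 + a 2 + a 3 + a 4 + a 5) = 12 * int n \<and>
     11 * int o1 = 121 * int n - (5 * a 1 + 9 * a 2 + 12 * a 3 + 14 * a 4 + 15 * a 5) \<and>
     11 * int o2 = 121 * int n - (9 * a 1 + 14 * a 2 + 15 * a 3 + 12 * a 4 + 5 * a 5) \<and>
     11 * int o3 = 121 * int n - (12 * a 1 + 15 * a 2 + 9 * a 3 + 5 * a 4 + 14 * a 5) \<and>
     11 * int o4 = 121 * int n - (14 * a 1 + 12 * a 2 + 5 * a 3 + 15 * a 4 + 9 * a 5) \<and>
     11 * int o5 = 121 * int n - (15 * a 1 + 5 * a 2 + 14 * a 3 + 9 * a 4 + 12 * a 5)"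
  unfolding cusp_data_def by blast

lemma cusp_order_values:
  "cusp_order (12 * n) a 1 = (121 * of_int n - of_int (5 * a 1 + 9 * a 2 + 12 * a 3 + 14 * a 4 + 15 * a 5)) / 121"
  "cusp_order (12 * n) a 2 = (121 * of_int n - of_int (9 * a 1 + 14 * a 2 + 15 * a 3 + 12 * a 4 + 5 * a 5)) / 121"
  "cusp_order (12 * n) a 3 = (121 * of_int n - of_int (12 * a 1 + 15 * a 2 + 9 * a 3 + 5 * a 4 + 14 * a 5)) / 121"
  "cusp_order (12 * n) a 4 = (121 * of_int n - of_int (14 * a 1 + 12 * a 2 + 5 * a 3 + 15 * a 4 + 9 * a 5)) / 121"
  "cusp_order (12 * n) a 5 = (121 * of_int n - of_int (15 * a 1 + 5 * a 2 + 14 * a 3 + 9 * a 4 + 12 * a 5)) / 121"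
  unfolding cusp_order_def sum_1_5 by (simp_all add: field_simps)

lemma L_11_iff_cusp_data:
  "a \<in> L 11 k \<longleftrightarrow> a \<in> {1..5} \<rightarrow>\<^sub>E UNIV \<and> (\<exists>n p. cusp_data k a n p)"
proof -
  define Q where "Q = a 1 + 4 * a 2 + 9 * a 3 + 16 * a 4 + 25 * a 5"
  define s where "s = int k + (a 1 + a 2 + a 3 + a 4 + a 5)"
  have Q: "(\<Sum>j=1..5. int j ^ 2 * a j) = Q" unfolding sum_1_5 Q_def by simp
  have s: "int k + (\<Sum>j=1..5. a j) = s" unfolding sum_1_5 s_def ..
  have "{1..5::int} = {1, 2, 3, 4, 5}" by auto
  then have "theta_quotient 11 (2 * k) a \<in> modular_forms k (Gamma1 11) \<longleftrightarrow>
     12 dvd s \<and> 0 \<le> s \<and> 11 dvd Q \<and> cusp_order s a 1 \<ge> 0 \<and> cusp_order s a 2 \<ge> 0 \<and> cusp_order s a 3 \<ge> 0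
     \<and> cusp_order s a 4 \<ge> 0 \<and> cusp_order s a 5 \<ge> 0" (is "_ \<longleftrightarrow> ?R")
    unfolding theta_quotient_11_modular_iff Q s by simp
  also have "?R \<longleftrightarrow> (\<exists>n p. cusp_data k a n p)"
  proof
    assume R: ?R
    then obtain n' where "s = 12 * n'" by blast
    with R obtain n where n: "s = 12 * int n" by (metis nonneg_int_cases zero_le_mult_iff not_numeral_le_zero)
    obtain q where q: "Q = 11 * q" using R by blast
    have le: "\<And>x. (0 \<le> (121 * real_of_int (int n) - of_int x) / 121) \<longleftrightarrow> x \<le> 121 * int n"
      by (simp add: zero_le_divide_iff) linarith
    have ineq: "5 * a 1 + 9 * a 2 + 12 * a 3 + 14 * a 4 + 15 * a 5 \<le> 121 * int n"
      "9 * a 1 + 14 * a 2 + 15 * a 3 + 12 * a 4 + 5 * a 5 \<le> 121 * int n"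
      "12 * a 1 + 15 * a 2 + 9 * a 3 + 5 * a 4 + 14 * a 5 \<le> 121 * int n"
      "14 * a 1 + 12 * a 2 + 5 * a 3 + 15 * a 4 + 9 * a 5 \<le> 121 * int n"
      "15 * a 1 + 5 * a 2 + 14 * a 3 + 9 * a 4 + 12 * a 5 \<le> 121 * int n"
      using R unfolding n cusp_order_values le by blast+
    \<comment> \<open>eliminating \<open>a\<^sub>1\<close> makes the divisibility of the five right-hand sides by \<open>11\<close> visible\<close>
    have a1: "a 1 = 11 * q - 4 * a 2 - 9 * a 3 - 16 * a 4 - 25 * a 5" using q by (simp add: Q_def)
    define b where "b = (\<lambda>i::nat. 11 * int n - (if i = 1 then 5 * q - a 2 - 3 * a 3 - 6 * a 4 - 10 * a 5
       else if i = 2 then 9 * q - 2 * a 2 - 6 * a 3 - 12 * a 4 - 20 * a 5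
       else if i = 3 then 12 * q - 3 * a 2 - 9 * a 3 - 17 * a 4 - 26 * a 5
       else if i = 4 then 14 * q - 4 * a 2 - 11 * a 3 - 19 * a 4 - 31 * a 5
       else 15 * q - 5 * a 2 - 11 * a 3 - 21 * a 4 - 33 * a 5))"
    have b: "11 * b 1 = 121 * int n - (5 * a 1 + 9 * a 2 + 12 * a 3 + 14 * a 4 + 15 * a 5)"
      "11 * b 2 = 121 * int n - (9 * a 1 + 14 * a 2 + 15 * a 3 + 12 * a 4 + 5 * a 5)"
      "11 * b 3 = 121 * int n - (12 * a 1 + 15 * a 2 + 9 * a 3 + 5 * a 4 + 14 * a 5)"
      "11 * b 4 = 121 * int n - (14 * a 1 + 12 * a 2 + 5 * a 3 + 15 * a 4 + 9 * a 5)"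
      "11 * b 5 = 121 * int n - (15 * a 1 + 5 * a 2 + 14 * a 3 + 9 * a 4 + 12 * a 5)"
      unfolding a1 by (simp_all add: b_def)
    then have "b 1 \<ge> 0" "b 2 \<ge> 0" "b 3 \<ge> 0" "b 4 \<ge> 0" "b 5 \<ge> 0" using ineq by linarith+
    then obtain o1 o2 o3 o4 o5 where o: "b 1 = int o1" "b 2 = int o2" "b 3 = int o3" "b 4 = int o4" "b 5 = int o5"
      by (metis nonneg_int_cases)
    have "cusp_data k a n [o5, o3, o4, o2, o1]"
      unfolding cusp_data_def using n b unfolding o s_def by blast
    then show "\<exists>n p. cusp_data k a n p" by blast
  next
    assume "\<exists>n p. cusp_data k a n p"
    then obtain n o1 o2 o3 o4 o5 where n: "s = 12 * int n" and
     o: "11 * int o1 = 121 * int n - (5 * a 1 + 9 * a 2 + 12 * a 3 + 14 * a 4 + 15 * a 5)"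
      "11 * int o2 = 121 * int n - (9 * a 1 + 14 * a 2 + 15 * a 3 + 12 * a 4 + 5 * a 5)"
      "11 * int o3 = 121 * int n - (12 * a 1 + 15 * a 2 + 9 * a 3 + 5 * a 4 + 14 * a 5)"
      "11 * int o4 = 121 * int n - (14 * a 1 + 12 * a 2 + 5 * a 3 + 15 * a 4 + 9 * a 5)"
      "11 * int o5 = 121 * int n - (15 * a 1 + 5 * a 2 + 14 * a 3 + 9 * a 4 + 12 * a 5)"
      unfolding cusp_data_def s_def by blast
    have "Q = 11 * (9 * (11 * int n - int o1) - (4 * a 1 + 7 * a 2 + 9 * a 3 + 10 * a 4 + 10 * a 5))"
      using o(1) by (simp add: Q_def)
    then have Q11: "11 dvd Q" by (metis dvd_triv_left)
    have nn: "0 \<le> (121 * real_of_int (int n) - of_int x) / 121" if "11 * int y = 121 * int n - x" for x y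
    proof -
      have "x \<le> 121 * int n" using that by linarith
      then have "real_of_int x \<le> of_int (121 * int n)" by (simp only: of_int_le_iff)
      then show ?thesis by simp
    qed
    show ?R
      unfolding n cusp_order_values
      by (intro conjI Q11 nn[OF o(1)] nn[OF o(2)] nn[OF o(3)] nn[OF o(4)] nn[OF o(5)]) simp_all
  qed
  finally show ?thesis by (simp add: L_def)
qed

lemma cusp_data_unique_list:
  assumes "cusp_data k a n p" "cusp_data k a n' p'"
  shows "p = p'"
proof -
  have "n = n'" using assms by (auto simp: cusp_data_def)
  then show ?thesis using assms by (auto simp: cusp_data_def)
qed

lemma cusp_data_sum:
  assumes "cusp_data k a n p"
  shows "int (sum_list p) = 5 * (int k - int n)"
proof -
  obtain o1 o2 o3 o4 o5 where p: "p = [o5, o3, o4, o2, o1]" and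
    n: "int k + (a 1 + a 2 + a 3 + a 4 + a 5) = 12 * int n" and
    o: "11 * int o1 = 121 * int n - (5 * a 1 + 9 * a 2 + 12 * a 3 + 14 * a 4 + 15 * a 5)"
      "11 * int o2 = 121 * int n - (9 * a 1 + 14 * a 2 + 15 * a 3 + 12 * a 4 + 5 * a 5)"
      "11 * int o3 = 121 * int n - (12 * a 1 + 15 * a 2 + 9 * a 3 + 5 * a 4 + 14 * a 5)"
      "11 * int o4 = 121 * int n - (14 * a 1 + 12 * a 2 + 5 * a 3 + 15 * a 4 + 9 * a 5)"
      "11 * int o5 = 121 * int n - (15 * a 1 + 5 * a 2 + 14 * a 3 + 9 * a 4 + 12 * a 5)"
    using assms unfolding cusp_data_def by blast
  have "11 * (int o1 + int o2 + int o3 + int o4 + int o5) = 55 * (int k - int n)"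
  proof -
    have k: "int k = 12 * int n - (a 1 + a 2 + a 3 + a 4 + a 5)" using n by simp
    show ?thesis unfolding distrib_left o k by simp
  qed
  then show ?thesis by (simp add: p)
qed

lemma cusp_data_unique_exponents:
  assumes "cusp_data k a n p" "cusp_data k b n' p" "j \<in> {1..5}"
  shows "a j = b j"
proof -
  have eq: "c 1 = d 1 \<and> c 2 = d 2 \<and> c 3 = d 3 \<and> c 4 = d 4 \<and> c 5 = d 5"
    if "R 1 = 5 * c 1 + 9 * c 2 + 12 * c 3 + 14 * c 4 + 15 * c 5" "R 1 =
        5 * d 1 + 9 * d 2 + 12 * d 3 + 14 * d 4 + 15 * d 5"
      "R 2 = 9 * c 1 + 14 * c 2 + 15 * c 3 + 12 * c 4 + 5 * c 5" "R 2 =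
          9 * d 1 + 14 * d 2 + 15 * d 3 + 12 * d 4 + 5 * d 5"
      "R 3 = 12 * c 1 + 15 * c 2 + 9 * c 3 + 5 * c 4 + 14 * c 5" "R 3 =
          12 * d 1 + 15 * d 2 + 9 * d 3 + 5 * d 4 + 14 * d 5"
      "R 4 = 14 * c 1 + 12 * c 2 + 5 * c 3 + 15 * c 4 + 9 * c 5" "R 4 =
          14 * d 1 + 12 * d 2 + 5 * d 3 + 15 * d 4 + 9 * d 5"
      "R 5 = 15 * c 1 + 5 * c 2 + 14 * c 3 + 9 * c 4 + 12 * c 5" "R 5 =
          15 * d 1 + 5 * d 2 + 14 * d 3 + 9 * d 4 + 12 * d 5"
    for R c d :: "nat \<Rightarrow> int"
  proof -
    \<comment> \<open>\<open>275\<close> times the inverse of the coefficient matrix\<close>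
    have inv: "275 * e 1 = - 19 * R 1 - 4 * R 2 + R 3 + 11 * R 4 + 16 * R 5"
      "275 * e 2 = - 4 * R 1 + 11 * R 2 + 16 * R 3 + R 4 - 19 * R 5"
      "275 * e 3 = R 1 + 16 * R 2 - 4 * R 3 - 19 * R 4 + 11 * R 5"
      "275 * e 4 = 11 * R 1 + R 2 - 19 * R 3 + 16 * R 4 - 4 * R 5"
      "275 * e 5 = 16 * R 1 - 19 * R 2 + 11 * R 3 - 4 * R 4 + R 5"
      if "R 1 = 5 * e 1 + 9 * e 2 + 12 * e 3 + 14 * e 4 + 15 * e 5"
        "R 2 = 9 * e 1 + 14 * e 2 + 15 * e 3 + 12 * e 4 + 5 * e 5"
        "R 3 = 12 * e 1 + 15 * e 2 + 9 * e 3 + 5 * e 4 + 14 * e 5"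
        "R 4 = 14 * e 1 + 12 * e 2 + 5 * e 3 + 15 * e 4 + 9 * e 5"
        "R 5 = 15 * e 1 + 5 * e 2 + 14 * e 3 + 9 * e 4 + 12 * e 5" for e :: "nat \<Rightarrow> int"
      unfolding that by simp_all
    note C = inv[of c, OF that(1,3,5,7,9)] and D = inv[of d, OF that(2,4,6,8,10)]
    have "c 1 = d 1" using C(1) D(1) by linarith
    moreover have "c 2 = d 2" using C(2) D(2) by linarith
    moreover have "c 3 = d 3" using C(3) D(3) by linarith
    moreover have "c 4 = d 4" using C(4) D(4) by linarith
    moreover have "c 5 = d 5" using C(5) D(5) by linarith
    ultimately show ?thesis by blast
  qed
  have "n = n'"
    using cusp_data_sum[OF assms(1)] cusp_data_sum[OF assms(2)] by simp
  obtain o1 o2 o3 o4 o5 where p: "p = [o5, o3, o4, o2, o1]"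
    using assms(1) unfolding cusp_data_def by blast
  define R where "R = (\<lambda>i::nat. 121 * int n - 11 * (if i = 1 then int o1 else if i = 2 then int o2
    else if i = 3 then int o3 else if i = 4 then int o4 else int o5))"
  have eq: "a 1 = b 1 \<and> a 2 = b 2 \<and> a 3 = b 3 \<and> a 4 = b 4 \<and> a 5 = b 5"
  proof (rule eq[of R])
    note A = assms(1)[unfolded p cusp_data_list] and B = assms(2)[unfolded p cusp_data_list, folded \<open>n = n'\<close>]
    show "R 1 = 5 * a 1 + 9 * a 2 + 12 * a 3 + 14 * a 4 + 15 * a 5"
      "R 2 = 9 * a 1 + 14 * a 2 + 15 * a 3 + 12 * a 4 + 5 * a 5"
      "R 3 = 12 * a 1 + 15 * a 2 + 9 * a 3 + 5 * a 4 + 14 * a 5"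
      "R 4 = 14 * a 1 + 12 * a 2 + 5 * a 3 + 15 * a 4 + 9 * a 5"
      "R 5 = 15 * a 1 + 5 * a 2 + 14 * a 3 + 9 * a 4 + 12 * a 5"
      using A by (simp_all add: R_def)
    show "R 1 = 5 * b 1 + 9 * b 2 + 12 * b 3 + 14 * b 4 + 15 * b 5"
      "R 2 = 9 * b 1 + 14 * b 2 + 15 * b 3 + 12 * b 4 + 5 * b 5"
      "R 3 = 12 * b 1 + 15 * b 2 + 9 * b 3 + 5 * b 4 + 14 * b 5"
      "R 4 = 14 * b 1 + 12 * b 2 + 5 * b 3 + 15 * b 4 + 9 * b 5"
      "R 5 = 15 * b 1 + 5 * b 2 + 14 * b 3 + 9 * b 4 + 12 * b 5"
      using B by (simp_all add: R_def)
  qed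
  have "j \<in> {1, 2, 3, 4, 5}" using assms(3) by auto
  then show ?thesis using eq by auto
qed

lemma cusp_data_imp_cusp_lists:
  assumes "cusp_data k a n p"
  shows "p \<in> cusp_lists k"
proof -
  obtain o1 o2 o3 o4 o5 where p: "p = [o5, o3, o4, o2, o1]" and
    n: "int k + (a 1 + a 2 + a 3 + a 4 + a 5) = 12 * int n" and
    o: "11 * int o1 = 121 * int n - (5 * a 1 + 9 * a 2 + 12 * a 3 + 14 * a 4 + 15 * a 5)"
      "11 * int o2 = 121 * int n - (9 * a 1 + 14 * a 2 + 15 * a 3 + 12 * a 4 + 5 * a 5)"
      "11 * int o3 = 121 * int n - (12 * a 1 + 15 * a 2 + 9 * a 3 + 5 * a 4 + 14 * a 5)"
      "11 * int o4 = 121 * int n - (14 * a 1 + 12 * a 2 + 5 * a 3 + 15 * a 4 + 9 * a 5)"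
      "11 * int o5 = 121 * int n - (15 * a 1 + 5 * a 2 + 14 * a 3 + 9 * a 4 + 12 * a 5)"
    using assms unfolding cusp_data_def by blast
  have sum: "int (sum_list p) = 5 * (int k - int n)" by (rule cusp_data_sum[OF assms])
  then have "5 * (int k - int n) \<ge> 0" by (metis of_nat_0_le_iff)
  then have le: "n \<le> k" by simp
  then obtain m where k: "k = n + m" using le_Suc_ex by blast
  define X where "X = int o2 + 3 * int o3 + 2 * int o4 + 4 * int o5 + 3 * int k + 4 * int m"
  \<comment> \<open>\<open>X\<close> is divisible by \<open>5\<close> because \<open>11 X\<close> is\<close>
  define Y where "Y = 418 * int n - 42 * a 1 - 36 * a 2 - 37 * a 3 - 34 * a 4 - 38 * a 5"
  have "11 * X = 11 * int o2 + 3 * (11 * int o3) + 2 * (11 * int o4) + 4 * (11 * int o5) + 33 * int k + 44 * int m"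
    by (simp add: X_def)
  also have "\<dots> = 5 * Y"
    using n k unfolding o Y_def by simp
  finally have "X = 5 * (Y - 2 * X)" by (simp add: algebra_simps)
  then have "5 dvd X" by (metis dvd_triv_left)
  moreover have "X = int (weight p + (3 * k + 4 * m))" by (simp add: X_def p)
  ultimately have "5 dvd weight p + (3 * k + 4 * m)" by presburger
  moreover have "sum_list p = 5 * m" using sum unfolding k by simp
  ultimately show ?thesis
    unfolding cusp_lists_def compositions_def using k by (intro UN_I[of m] CollectI conjI) (simp_all add: p)
qed

lemma cusp_lists_imp_cusp_data:
  assumes "p \<in> cusp_lists k"
  obtains a n where "a \<in> {1..5} \<rightarrow>\<^sub>E UNIV" "cusp_data k a n p"
proof -
  obtain m where m: "m \<le> k" "length p = 5" "sum_list p = 5 * m" "5 dvd weight p + (3 * k + 4 * m)"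
    using assms by (auto simp: cusp_lists_def compositions_def)
  obtain o1 o2 o3 o4 o5 where p: "p = [o5, o3, o4, o2, o1]"
    using m(2) by (auto simp: numeral_eq_Suc length_Suc_conv)
  obtain n where k: "k = n + m" using m(1) le_Suc_ex by (metis add.commute)
  have "5 dvd int (weight p + (3 * k + 4 * m))" using m(4) by presburger
  then obtain w' where w': "int (weight p + (3 * k + 4 * m)) = 5 * w'" by blast
  define w where "w = w' - int n - 2 * int m"
  have w: "int o2 + 3 * int o3 + 2 * int o4 + 4 * int o5 = 2 * int n + 3 * int m + 5 * w"
    using w' by (simp add: p k w_def)
  have sum: "int o1 + int o2 + int o3 + int o4 + int o5 = 5 * int m"
    using m(3) by (simp add: p)
  have o2: "int o2 = 2 * int n + 3 * int m + 5 * w - 3 * int o3 - 2 * int o4 - 4 * int o5"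
    using w by linarith
  have o1: "int o1 = 2 * int m - 2 * int n - 5 * w + 2 * int o3 + int o4 + 3 * int o5"
    using sum o2 by linarith
  \<comment> \<open>the solution of the linear system, in which the congruence has cleared all denominators\<close>
  define a where "a = restrict (\<lambda>j. if j = 1 then int n + 2 * int m - 3 * w + int o3 + int o5
     else if j = 2 then int n - int m - 3 * w + int o3 + int o4 + 3 * int o5
     else if j = 3 then int n - 2 * int m - 3 * w + 2 * int o3 + 2 * int o4 + 2 * int o5
     else if j = 4 then 3 * int n - int m + 2 * w - int o4 - int o5
     else 5 * int n + int m + 7 * w - 4 * int o3 - 2 * int o4 - 5 * int o5) {1..5::nat}"
  have "cusp_data k a n p"
    unfolding cusp_data_def
    by (rule exI[of _ o1], rule exI[of _ o2], rule exI[of _ o3], rule exI[of _ o4], rule exI[of _ o5])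
       (simp add: p a_def k o1 o2)
  moreover have "a \<in> {1..5} \<rightarrow>\<^sub>E UNIV" by (simp add: a_def)
  ultimately show thesis using that by blast
qed

lemma card_L_11: "finite (L 11 k)" "card (L 11 k) = card (cusp_lists k)"
proof -
  define f where "f = (\<lambda>a. SOME p. \<exists>n. cusp_data k a n p)"
  have f: "f a = p" if "cusp_data k a n p" for a n p
    unfolding f_def using that by (auto intro!: some_equality dest: cusp_data_unique_list)
  have "bij_betw f (L 11 k) (cusp_lists k)"
  proof (rule bij_betwI')
    fix a b assume "a \<in> L 11 k" "b \<in> L 11 k"
    then obtain n p n' p' where ab: "a \<in> {1..5} \<rightarrow>\<^sub>E UNIV" "b \<in> {1..5} \<rightarrow>\<^sub>E UNIV" "cusp_data k a n p" "cusp_data k b n' p'"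
      unfolding L_11_iff_cusp_data by blast
    show "f a = f b \<longleftrightarrow> a = b"
    proof
      assume "f a = f b"
      then have "p = p'" using f ab(3,4) by metis
      then have "a j = b j" if "j \<in> {1..5}" for j
        using cusp_data_unique_exponents that ab(3,4) by blast
      then show "a = b" using ab(1,2) by (rule PiE_ext[rotated 2])
    qed simp
  next
    fix a assume "a \<in> L 11 k"
    then show "f a \<in> cusp_lists k"
      unfolding L_11_iff_cusp_data using f cusp_data_imp_cusp_lists by metis
  next
    fix p assume "p \<in> cusp_lists k"
    then show "\<exists>a\<in>L 11 k. p = f a"
      unfolding Bex_def L_11_iff_cusp_data using f cusp_lists_imp_cusp_data by metis
  qed
  then show "finite (L 11 k)" "card (L 11 k) = card (cusp_lists k)"
    using finite_cusp_lists bij_betw_finite bij_betw_same_card by auto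
qed

theorem theorem5p2:
  fixes k :: nat
  shows "finite (L 11 k) \<and>
    real (card (L 11 k)) =
      25 * real k ^ 5 / 24 + 125 * real k ^ 4 / 24 + 75 * real k ^ 3 / 8
      + 175 * real k ^ 2 / 24 + 137 * real k / 60 + 1 / 5 + E11 k"
  using card_L_11 card_cusp_lists by simp

end
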